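(* Let $d=d(n)=n/2-\eta$, where $\eta=\eta(n)$ satisfies $\eta=\omega(1)$ and $\eta=o(n)$. Then the sharp $d$-threshold for Hamiltonicity is $16\eta/n^2$. That is, for every fixed $\epsilon>0$: (0) there exists a sequence of $n$-vertex graphs $\{H_n\}_{n\in\mathbb{N}}$ with $\delta(H_n)\geq d$ such that, if $p\leq(1-\epsilon)16\eta/n^2$, then $\lim_{n\to\infty}\mathbb{P}[H_n\cup G(n,p)\text{ is Hamiltonian}]=0$; and (1) for every sequence of $n$-vertex graphs $\{H_n\}_{n\in\mathbb{N}}$ with $\delta(H_n)\geq d$, if $p\geq(1+\epsilon)16\eta/n^2$, then $\lim_{n\to\infty}\mathbb{P}[H_n\cup G(n,p)\text{ is Hamiltonian}]=1$.
   Context: All graphs are simple. $G(n,p)$ is the binomial random graph on the same $n$-vertex set as $H_n$, obtained by including each of the $\binom{n}{2}$ possible edges independently with probability $p$; $H_n\cup G(n,p)$ is the union of the edge sets. A graph is Hamiltonian if it contains a cycle through all its vertices. $\delta(\cdot)$ denotes minimum degree. Since $d$ is an integer, $\eta$ is an integer when $n$ is even and a half-integer when $n$ is odd. Asymptotic notation is as $n\to\infty$. *)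

theory Defs
  imports "HOL-Probability.Probability" "HOL-Library.Ramsey" "HOL-Library.Landau_Symbols"
begin

text \<open>
  A simple graph on \<open>n\<close> vertices has vertex set \<open>{..<n}\<close> and is represented by its edge set,
  a set of two-element subsets of \<open>{..<n}\<close>.
\<close>

definition potential_edges :: "nat \<Rightarrow> nat set set" where
  "potential_edges n = nsets {..<n} 2"

definition simple_graph :: "nat \<Rightarrow> nat set set \<Rightarrow> bool" where
  "simple_graph n E \<longleftrightarrow> E \<subseteq> potential_edges n"

definition degree :: "nat set set \<Rightarrow> nat \<Rightarrow> nat" where
  "degree E v = card {e \<in> E. v \<in> e}"

text \<open>Unspecified for \<open>n = 0\<close>, being the minimum of the empty set.\<close>

definition min_degree :: "nat \<Rightarrow> nat set set \<Rightarrow> nat" where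
  "min_degree n E = Min (degree E ` {..<n})"

text \<open>A cycle is given by the list of its vertices in cyclic order, without repeating the first.\<close>

definition is_cycle :: "nat set set \<Rightarrow> nat list \<Rightarrow> bool" where
  "is_cycle E vs \<longleftrightarrow> 3 \<le> length vs \<and> distinct vs \<and>
     (\<forall>i < length vs. {vs ! i, vs ! (Suc i mod length vs)} \<in> E)"

definition hamiltonian :: "nat \<Rightarrow> nat set set \<Rightarrow> bool" where
  "hamiltonian n E \<longleftrightarrow> (\<exists>vs. is_cycle E vs \<and> set vs = {..<n})"

definition random_graph :: "nat \<Rightarrow> real \<Rightarrow> nat set set pmf" where
  "random_graph n p =
     map_pmf (\<lambda>X. {e \<in> potential_edges n. X e})
       (Pi_pmf (potential_edges n) False (\<lambda>_. bernoulli_pmf p))"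

end

theory Submission imports Defs begin

text \<open>
  A Hamilton cycle in the union of the complete bipartite graph with parts of size \<open>d\<close> and \<open>n - d\<close> and a
  graph \<open>R\<close> needs \<open>n - 2d = 2\<eta>\<close> edges of \<open>R\<close> inside the larger part, where \<open>G(n,p)\<close> has about \<open>p n\<^sup>2 / 8\<close>
  edges; this gives the lower bound.

  For the upper bound, a graph of minimum degree at least \<open>d\<close> that has a cycle through nearly all
  vertices and no stable set of more than \<open>d\<close> vertices is Hamiltonian (Nash-Williams): a longest cycle \<open>C\<close>
  has a stable complement, and the \<open>C\<close>-successors of the neighbours of an uncovered vertex \<open>v\<close>, together
  with \<open>v\<close>, form a stable set of size \<open>d + 1\<close>.  A longest-path argument shows that \<open>H\<close> has a long cycle or
  contains two disjoint, almost complete subgraphs on about half the vertices each, and then two disjoint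
  random edges between them give a long cycle.  If \<open>S\<close> is a stable set of \<open>H\<close> with more than \<open>d\<close>
  vertices, a matching of size \<open>n - 2d\<close> in \<open>R[S]\<close> excludes every stable set of \<open>H \<union> R\<close> of more than \<open>d\<close>
  vertices that meets \<open>S\<close>.  So it suffices that \<open>R\<close> has a matching of size \<open>n - 2d\<close> inside each of three
  fixed sets of at least \<open>d(d+1)/2\<close> pairs, and since \<open>R\<close> has few pairs of incident edges this
  follows from the concentration of the number of its edges in these sets.
\<close>

section \<open>Neighbourhoods, cycles and longest cycles\<close>

definition adj :: "nat set set \<Rightarrow> nat \<Rightarrow> nat \<Rightarrow> bool" where
  "adj E x y \<longleftrightarrow> {x, y} \<in> E"

definition nbrs :: "nat set set \<Rightarrow> nat \<Rightarrow> nat set" where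
  "nbrs E v = {u. adj E v u}"

definition stable :: "nat set set \<Rightarrow> nat set \<Rightarrow> bool" where
  "stable E S \<longleftrightarrow> (\<forall>x\<in>S. \<forall>y\<in>S. \<not> adj E x y)"

lemma adj_sym: "adj E x y \<longleftrightarrow> adj E y x"
  by (simp add: adj_def insert_commute)

lemma nbrs_iff [simp]: "u \<in> nbrs E v \<longleftrightarrow> adj E v u"
  by (simp add: nbrs_def)

lemma potential_edges_iff: "{x, y} \<in> potential_edges n \<longleftrightarrow> x < n \<and> y < n \<and> x \<noteq> y"
  by (auto simp: potential_edges_def nsets_def card_insert_if)

lemma finite_potential_edges [simp]: "finite (potential_edges n)"
  by (simp add: potential_edges_def finite_imp_finite_nsets)

lemma adjD:
  assumes "simple_graph n E" "adj E x y"
  shows "x < n" "y < n" "x \<noteq> y"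
  using assms potential_edges_iff unfolding simple_graph_def adj_def by blast+

lemma nbrs_subset: "simple_graph n E \<Longrightarrow> nbrs E v \<subseteq> {..<n} - {v}"
  using adjD by fastforce

lemma finite_nbrs: "simple_graph n E \<Longrightarrow> finite (nbrs E v)"
  by (rule finite_subset[OF nbrs_subset]) auto

lemma degree_eq_card_nbrs:
  assumes "simple_graph n E"
  shows "degree E v = card (nbrs E v)"
proof -
  have "bij_betw (\<lambda>u. {v, u}) (nbrs E v) {e \<in> E. v \<in> e}"
  proof (rule bij_betwI')
    fix e assume "e \<in> {e \<in> E. v \<in> e}"
    then have e: "e \<in> E" "v \<in> e" by auto
    then have "card e = 2"
      using assms by (auto simp: simple_graph_def potential_edges_def nsets_def)
    then obtain u where "e = {v, u}"
      using e(2) by (auto simp: card_2_iff)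
    then show "\<exists>u\<in>nbrs E v. e = {v, u}"
      using e by (auto simp: adj_def)
  qed (auto simp: adj_def doubleton_eq_iff)
  then show ?thesis
    unfolding degree_def by (simp add: bij_betw_same_card)
qed

lemma card_nbrs_ge_min_degree:
  assumes "simple_graph n E" "v < n" "d \<le> min_degree n E"
  shows "d \<le> card (nbrs E v)"
proof -
  have "min_degree n E \<le> degree E v"
    unfolding min_degree_def using assms(2) by (intro Min_le) auto
  then show ?thesis using assms degree_eq_card_nbrs by simp
qed

section \<open>Cycles as lists and their rotations\<close>

lemma is_cycle_iff:
  "is_cycle E vs \<longleftrightarrow> 3 \<le> length vs \<and> distinct vs \<and> successively (adj E) vs \<and> adj E (last vs) (hd vs)"
proof (cases "3 \<le> length vs")
  case True
  then have ne: "vs \<noteq> []" and l: "length vs = Suc (length vs - 1)" by auto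
  have "(\<forall>i<length vs. {vs ! i, vs ! (Suc i mod length vs)} \<in> E) \<longleftrightarrow>
        (\<forall>i<length vs - 1. adj E (vs ! i) (vs ! Suc i)) \<and> adj E (last vs) (hd vs)"
    (is "(\<forall>i<_. ?P i) \<longleftrightarrow> _")
  proof -
    have "(\<forall>i<length vs. ?P i) \<longleftrightarrow> (\<forall>i<length vs - 1. ?P i) \<and> ?P (length vs - 1)"
      using l by (metis less_Suc_eq)
    moreover have "?P (length vs - 1) \<longleftrightarrow> adj E (last vs) (hd vs)"
      using l ne by (metis adj_def hd_conv_nth last_conv_nth mod_self)
    moreover have "?P i \<longleftrightarrow> adj E (vs ! i) (vs ! Suc i)" if "i < length vs - 1" for i
      using that by (simp add: adj_def)
    ultimately show ?thesis by blast
  qed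
  moreover have "successively (adj E) vs \<longleftrightarrow> (\<forall>i<length vs - 1. adj E (vs ! i) (vs ! Suc i))"
    by (simp add: successively_conv_nth less_diff_conv)
  ultimately show ?thesis using True by (auto simp: is_cycle_def)
qed (auto simp: is_cycle_def)

lemma is_cycle_appendI:
  assumes "xs \<noteq> []" "ys \<noteq> []" "3 \<le> length xs + length ys" "distinct xs" "distinct ys"
    "set xs \<inter> set ys = {}" "successively (adj E) xs" "successively (adj E) ys"
    "adj E (last xs) (hd ys)" "adj E (last ys) (hd xs)"
  shows "is_cycle E (xs @ ys)"
  using assms by (simp add: is_cycle_iff successively_append_iff)

lemma is_cycle_append_commute: "is_cycle E (xs @ ys) \<Longrightarrow> is_cycle E (ys @ xs)"
  by (cases "xs = [] \<or> ys = []") (auto simp: is_cycle_iff successively_append_iff adj_sym)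

lemma is_cycle_rotate: "is_cycle E vs \<Longrightarrow> is_cycle E (rotate k vs)"
  by (metis append_take_drop_id is_cycle_append_commute rotate_drop_take)

lemma successively_adj_rev [simp]: "successively (adj E) (rev xs) \<longleftrightarrow> successively (adj E) xs"
proof -
  have "(\<lambda>x y. adj E y x) = adj E" by (intro ext) (rule adj_sym)
  then show ?thesis by (metis successively_rev)
qed

lemma inj_on_Suc_mod: "inj_on (\<lambda>i. Suc i mod c) {..<c}"
proof (rule inj_onI)
  fix i j assume "i \<in> {..<c}" "j \<in> {..<c}" "Suc i mod c = Suc j mod c"
  then show "i = j" by (cases "Suc i = c"; cases "Suc j = c") auto
qed

text \<open>Cycle surgery below cuts the cycle just after a chosen vertex. Rotating that vertex to
  the end of the list turns the cut into concatenation.\<close>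

lemma cycle_rotation_at:
  assumes "is_cycle E vs" "i < length vs"
  obtains ws where "is_cycle E ws" "length ws = length vs" "set ws = set vs"
    "last ws = vs ! i" "\<And>k. k < length vs \<Longrightarrow> ws ! k = vs ! ((Suc i + k) mod length vs)"
proof
  let ?ws = "rotate (Suc i) vs"
  show "is_cycle E ?ws" by (rule is_cycle_rotate[OF assms(1)])
  show "length ?ws = length vs" "set ?ws = set vs" by simp_all
  show nth: "?ws ! k = vs ! ((Suc i + k) mod length vs)" if "k < length vs" for k
    using nth_rotate[OF that, of "Suc i"] by (simp only:)
  have "?ws ! (length vs - 1) = vs ! ((Suc i + (length vs - 1)) mod length vs)"
    using assms(2) by (intro nth) auto
  also have "Suc i + (length vs - 1) = i + length vs" using assms(2) by simp
  finally show "last ?ws = vs ! i"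
    using assms(2) by (metis gr_implies_not0 last_conv_nth length_0_conv length_rotate mod_add_self2 mod_less)
qed

section \<open>Extremal properties of longest cycles\<close>

definition longest_cycle :: "nat set set \<Rightarrow> nat list \<Rightarrow> bool" where
  "longest_cycle E vs \<longleftrightarrow> is_cycle E vs \<and> (\<forall>ws. is_cycle E ws \<longrightarrow> length ws \<le> length vs)"

lemma longest_cycleD: "longest_cycle E vs \<Longrightarrow> is_cycle E ws \<Longrightarrow> length ws \<le> length vs"
  by (simp add: longest_cycle_def)

text \<open>Otherwise \<open>u\<close> could be inserted between two consecutive vertices.\<close>

lemma not_both_adj_successive:
  assumes C: "longest_cycle E vs" and i: "i < length vs"
    and u: "u \<notin> set vs" and "adj E u (vs ! i)"
  shows "\<not> adj E u (vs ! (Suc i mod length vs))"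
proof
  assume b: "adj E u (vs ! (Suc i mod length vs))"
  obtain ws where ws: "is_cycle E ws" "length ws = length vs" "set ws = set vs" "last ws = vs ! i"
    "\<And>k. k < length vs \<Longrightarrow> ws ! k = vs ! ((Suc i + k) mod length vs)"
    using cycle_rotation_at[OF _ i] C unfolding longest_cycle_def by metis
  have "hd ws = vs ! (Suc i mod length vs)"
    using ws(5)[of 0] ws(2) i by (metis add.right_neutral gr_implies_not0 hd_conv_nth length_0_conv not_gr0)
  then have "is_cycle E (ws @ [u])"
    using ws(1,3,4) u assms(4) b
    by (intro is_cycle_appendI) (auto simp: is_cycle_iff adj_sym[of E u])
  from longest_cycleD[OF C this] show False using ws(2) by simp
qed

text \<open>The ends of an edge off the cycle could be inserted between two consecutive vertices, a
  gain of two, or could replace the single vertex between a neighbour of \<open>u\<close> and a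
  neighbour of \<open>w\<close>, still a gain of one.\<close>

lemma not_adj_across_edge:
  assumes C: "longest_cycle E vs" and i: "i < length vs"
    and u: "u \<notin> set vs" "w \<notin> set vs" "u \<noteq> w" "adj E u w" and a: "adj E u (vs ! i)"
  shows "\<not> adj E w (vs ! (Suc i mod length vs))"
    and "\<not> adj E w (vs ! (Suc (Suc i mod length vs) mod length vs))"
proof -
  obtain ws where ws: "is_cycle E ws" "length ws = length vs" "set ws = set vs" "last ws = vs ! i"
    "\<And>k. k < length vs \<Longrightarrow> ws ! k = vs ! ((Suc i + k) mod length vs)"
    using cycle_rotation_at[OF _ i] C unfolding longest_cycle_def by metis
  have l3: "3 \<le> length ws" using ws(1) by (simp add: is_cycle_def)
  have hd: "hd ws = vs ! (Suc i mod length vs)"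
    using ws(5)[of 0] ws(2) l3 by (cases ws) force+
  have ne: "ws \<noteq> []" "tl ws \<noteq> []" using l3 by (cases ws; force)+
  have "hd (tl ws) = ws ! 1" using ne l3 by (simp add: hd_conv_nth nth_tl)
  also have "\<dots> = vs ! ((Suc i + 1) mod length vs)" using l3 ws(2) by (intro ws(5)) simp
  also have "(Suc i + 1) mod length vs = Suc (Suc i mod length vs) mod length vs"
    by (simp only: mod_Suc_eq) simp
  finally have hd': "hd (tl ws) = vs ! (Suc (Suc i mod length vs) mod length vs)" .
  show "\<not> adj E w (vs ! (Suc i mod length vs))"
  proof
    assume "adj E w (vs ! (Suc i mod length vs))"
    moreover have "adj E (last ws) u" using a ws(4) adj_sym by metis
    ultimately have "is_cycle E (ws @ [u, w])"
      using ws(1) u hd l3 ne unfolding ws(3)[symmetric]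
      by (intro is_cycle_appendI) (simp_all add: is_cycle_iff)
    from longest_cycleD[OF C this] show False using ws(2) by simp
  qed
  show "\<not> adj E w (vs ! (Suc (Suc i mod length vs) mod length vs))"
  proof
    assume b: "adj E w (vs ! (Suc (Suc i mod length vs) mod length vs))"
    define zs where "zs = tl ws"
    have xzs: "ws = hd ws # zs" using ne(1) by (simp add: zs_def)
    have zs: "zs \<noteq> []" "Suc (length zs) = length ws" using ne by (simp_all add: zs_def)
    have cyc: "distinct (hd ws # zs)" "successively (adj E) (hd ws # zs)"
      using ws(1) xzs by (simp_all add: is_cycle_iff)
    then have zs2: "distinct zs" "successively (adj E) zs"
      using zs(1) by (simp_all add: successively_Cons)
    have zs3: "last zs = vs ! i" using ws(4) ne by (simp add: zs_def last_tl)
    have zs4: "set zs \<subseteq> set vs" using ws(3) ne unfolding zs_def by (metis list.set_sel(2) subsetI)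
    have "hd zs = vs ! (Suc (Suc i mod length vs) mod length vs)" using hd' by (simp add: zs_def)
    moreover have "adj E (last zs) u" using a zs3 adj_sym by metis
    moreover have "u \<notin> set zs" "w \<notin> set zs" using u zs4 by blast+
    ultimately have "is_cycle E (zs @ [u, w])"
      using zs zs2 b u l3 by (intro is_cycle_appendI) simp_all
    from longest_cycleD[OF C this] show False using ws(2) zs(2) by simp
  qed
qed

lemma card_index_set:
  assumes "distinct vs"
  shows "card {i. i < length vs \<and> vs ! i \<in> N} = card (N \<inter> set vs)"
proof -
  have "bij_betw ((!) vs) {i. i < length vs \<and> vs ! i \<in> N} (N \<inter> set vs)"
    using assms by (auto simp: bij_betw_def inj_on_def nth_eq_iff_index_eq in_set_conv_nth image_iff)
  then show ?thesis by (rule bij_betw_same_card)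
qed

text \<open>Consider the positions \<open>X\<close> of the neighbours of \<open>u\<close>, their
  shift by one, and the shift by two of the positions \<open>Y\<close> of the neighbours of
  \<open>w\<close>. Insertion arguments make these three sets pairwise disjoint, so their sizes add
  up to at most the length.\<close>

lemma longest_cycle_edge_outside_bound:
  assumes C: "longest_cycle E vs"
    and u: "u \<notin> set vs" "w \<notin> set vs" "u \<noteq> w" "adj E u w"
  shows "2 * card (nbrs E u \<inter> set vs) + card (nbrs E w \<inter> set vs) \<le> length vs"
proof -
  define c where "c = length vs"
  define s where "s i = Suc i mod c" for i
  define X where "X = {i. i < c \<and> vs ! i \<in> nbrs E u}"
  define Y where "Y = {i. i < c \<and> vs ! i \<in> nbrs E w}"
  have dist: "distinct vs" using C by (simp add: longest_cycle_def is_cycle_def)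
  have cX: "card X = card (nbrs E u \<inter> set vs)" and cY: "card Y = card (nbrs E w \<inter> set vs)"
    using card_index_set[OF dist] by (simp_all add: X_def Y_def c_def del: nbrs_iff)
  have inj: "inj_on s {..<c}" using inj_on_Suc_mod unfolding s_def .
  have sl: "s i < c" if "i < c" for i using that by (simp add: s_def)
  have sub: "X \<subseteq> {..<c}" "Y \<subseteq> {..<c}" "s ` X \<subseteq> {..<c}" "s ` Y \<subseteq> {..<c}" "s ` s ` Y \<subseteq> {..<c}"
    using sl by (auto simp: X_def Y_def)
  have 1: "X \<inter> s ` X = {}"
    using not_both_adj_successive[OF C] u by (auto simp: X_def s_def c_def)
  have YX: "s ` Y \<inter> X = {}" "s ` s ` Y \<inter> X = {}"
    using not_adj_across_edge[OF C] u(1-3) u(4)[unfolded adj_sym[of E u]]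
    by (fastforce simp: X_def Y_def s_def c_def)+
  have 2: "s ` s ` Y \<inter> s ` X = {}"
    using YX(1) inj_on_image_Int[OF inj sub(4,1)] by auto
  have cs: "card (s ` X) = card X" "card (s ` Y) = card Y" "card (s ` s ` Y) = card Y"
    using inj sub by (metis card_image inj_on_subset)+
  have fin: "finite X" "finite Y" using sub by (auto intro: finite_subset)
  have "card (X \<union> s ` X \<union> s ` s ` Y) = card X + card X + card Y"
    using 1 2 YX(2) fin cs by (simp add: card_Un_disjoint Int_Un_distrib2 Int_commute)
  moreover have "card (X \<union> s ` X \<union> s ` s ` Y) \<le> card {..<c}"
    using sub by (intro card_mono) auto
  ultimately show ?thesis using cX cY by (simp add: c_def)
qed

text \<open>A vertex off the cycle has at least \<open>d - (n - length vs - 1)\<close> neighbours on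
  it. For an edge off the cycle the preceding bound would give
  \<open>3 * (d + length vs + 1 - n) \<le> length vs\<close>, which \<open>long\<close>
  excludes.\<close>

lemma outside_longest_cycle_stable:
  assumes G: "simple_graph n E" and C: "longest_cycle E vs"
    and V: "set vs \<subseteq> {..<n}" and deg: "\<And>v. v < n \<Longrightarrow> d \<le> card (nbrs E v)"
    and long: "3 * n < 2 * length vs + 3 * d + 3"
  shows "stable E ({..<n} - set vs)"
  unfolding stable_def
proof (intro ballI notI)
  fix u w assume u: "u \<in> {..<n} - set vs" and w: "w \<in> {..<n} - set vs" and uw: "adj E u w"
  have cv: "card (set vs) = length vs"
    using C by (auto simp: longest_cycle_def is_cycle_def distinct_card)
  have le: "length vs \<le> n" using card_mono[OF _ V] cv by simp
  have B: "d + length vs + 1 \<le> card (nbrs E x \<inter> set vs) + n" if x: "x \<in> {..<n} - set vs" for x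
  proof -
    have "nbrs E x \<subseteq> (nbrs E x \<inter> set vs) \<union> ({..<n} - set vs - {x})"
      using nbrs_subset[OF G] by auto
    then have "card (nbrs E x) \<le> card ((nbrs E x \<inter> set vs) \<union> ({..<n} - set vs - {x}))"
      by (intro card_mono) auto
    also have "\<dots> \<le> card (nbrs E x \<inter> set vs) + card ({..<n} - set vs - {x})"
      by (rule card_Un_le)
    also have "card ({..<n} - set vs - {x}) = n - length vs - 1"
      using x V cv by (simp add: card_Diff_subset)
    finally have "card (nbrs E x) \<le> card (nbrs E x \<inter> set vs) + (n - length vs - 1)" .
    moreover have "n - length vs \<ge> 1"
    proof -
      have "card ({..<n} - set vs) = n - length vs" using V cv by (simp add: card_Diff_subset)
      moreover have "card ({..<n} - set vs) \<ge> 1" using x by (metis One_nat_def Suc_leI card_gt_0_iff empty_iff finite_Diff finite_lessThan)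
      ultimately show ?thesis by simp
    qed
    ultimately show ?thesis using deg[of x] x le by auto
  qed
  have "2 * card (nbrs E u \<inter> set vs) + card (nbrs E w \<inter> set vs) \<le> length vs"
    using u w uw adjD(3)[OF G uw] by (intro longest_cycle_edge_outside_bound[OF C]) auto
  then show False using B[OF u] B[OF w] long by linarith
qed

text \<open>Cutting the cycle after both neighbours of \<open>v\<close> gives two arcs
  \<open>P\<close> and \<open>Q\<close>. Following \<open>P\<close>, then \<open>v\<close>, then
  \<open>Q\<close> backwards, and closing with the edge between the two successors would give a
  longer cycle.\<close>

lemma longest_cycle_successors_not_adj:
  assumes C: "longest_cycle E vs" and ij: "i < length vs" "j < length vs" "i \<noteq> j"
    and v: "v \<notin> set vs" "adj E v (vs ! i)" "adj E v (vs ! j)"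
  shows "\<not> adj E (vs ! (Suc i mod length vs)) (vs ! (Suc j mod length vs))"
proof
  assume a: "adj E (vs ! (Suc i mod length vs)) (vs ! (Suc j mod length vs))"
  let ?c = "length vs"
  obtain ws where ws: "is_cycle E ws" "length ws = length vs" "set ws = set vs" "last ws = vs ! i"
    "\<And>k. k < length vs \<Longrightarrow> ws ! k = vs ! ((Suc i + k) mod length vs)"
    using cycle_rotation_at[OF _ ij(1)] C unfolding longest_cycle_def by metis
  \<comment> \<open>\<open>k\<close> is the position of \<open>vs ! j\<close> in the rotated list,
    that is \<open>j - i - 1\<close> modulo the length.\<close>
  define k where "k = (if i < j then j - i - 1 else j + ?c - i - 1)"
  have "Suc i + k = (if i < j then j else j + ?c)" using ij by (auto simp: k_def)
  then have k: "Suc k < ?c" "(Suc i + k) mod ?c = j"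
    using ij by (auto simp: k_def)
  then have k': "(Suc i + Suc k) mod ?c = Suc j mod ?c"
    by (metis add_Suc_right mod_Suc_eq)
  define P where "P = take (Suc k) ws"
  define Q where "Q = drop (Suc k) ws"
  have PQ: "ws = P @ Q" "P \<noteq> []" "Q \<noteq> []" using k ws(2) by (auto simp: P_def Q_def)
  have lP: "last P = vs ! j"
    using k ws(2,5) by (simp add: P_def take_Suc_conv_app_nth)
  have hQ: "hd Q = vs ! (Suc j mod ?c)"
    using k k' ws(2) ws(5)[of "Suc k"] by (simp add: Q_def hd_drop_conv_nth)
  have hP: "hd P = vs ! (Suc i mod ?c)"
    using ws(5)[of 0] k ws(2) PQ(2) by (metis P_def add.right_neutral gr_implies_not0 hd_conv_nth hd_take length_0_conv not_gr0 zero_less_Suc)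
  have "is_cycle E (P @ [v] @ rev Q)"
    using ws(1,3,4) PQ lP hQ hP v a
    by (auto simp: is_cycle_iff successively_append_iff adj_sym hd_rev last_rev successively_Cons)
  from longest_cycleD[OF C this] show False using ws(2) PQ(1) by simp
qed

text \<open>Taking successors is injective, so no size is lost in passing from the neighbours of
  \<open>v\<close> to their successors; \<open>v\<close> is adjacent to none of the latter because
  it cannot be inserted.\<close>

lemma longest_cycle_stable_set:
  assumes G: "simple_graph n E" and C: "longest_cycle E vs"
    and V: "set vs \<subseteq> {..<n}" and v: "v < n" "v \<notin> set vs" and N: "nbrs E v \<subseteq> set vs"
  obtains S where "S \<subseteq> {..<n}" "stable E S" "card S = Suc (card (nbrs E v))"
proof -
  define c where "c = length vs"
  define X where "X = {i. i < c \<and> vs ! i \<in> nbrs E v}"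
  define T where "T = (\<lambda>i. vs ! (Suc i mod c)) ` X"
  have dist: "distinct vs" and c: "c > 0" using C by (auto simp: longest_cycle_def is_cycle_def c_def)
  have cX: "card X = card (nbrs E v)"
    using card_index_set[OF dist, of "nbrs E v"] N by (simp add: X_def c_def Int_absorb2 del: nbrs_iff)
  have "inj_on (\<lambda>i. vs ! (Suc i mod c)) X"
  proof (rule inj_onI)
    fix i j assume ij: "i \<in> X" "j \<in> X" "vs ! (Suc i mod c) = vs ! (Suc j mod c)"
    then have "Suc i mod c = Suc j mod c"
      using dist c by (simp add: nth_eq_iff_index_eq c_def)
    from inj_onD[OF inj_on_Suc_mod this] show "i = j" using ij(1,2) by (simp add: X_def)
  qed
  then have cT: "card T = card (nbrs E v)" using cX by (simp add: T_def card_image)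
  have Tsub: "T \<subseteq> set vs" using c by (auto simp: T_def c_def)
  have fT: "finite T" using Tsub finite_subset by blast
  have vT: "\<not> adj E v t" if "t \<in> T" for t
    using that not_both_adj_successive[OF C _ v(2)] by (auto simp: T_def X_def c_def)
  have TT: "\<not> adj E t t'" if tt: "t \<in> T" "t' \<in> T" for t t'
  proof
    assume a: "adj E t t'"
    obtain i j where ij: "i \<in> X" "j \<in> X" "t = vs ! (Suc i mod c)" "t' = vs ! (Suc j mod c)"
      using tt unfolding T_def by blast
    have "i \<noteq> j" using ij a adjD(3)[OF G] by blast
    then show False
      using longest_cycle_successors_not_adj[OF C, of i j v] ij a v by (auto simp: X_def c_def)
  qed
  show ?thesis
  proof
    show "insert v T \<subseteq> {..<n}" using v V Tsub by auto
    show "stable E (insert v T)"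
      using vT TT adjD(3)[OF G] unfolding stable_def by (metis adj_sym insert_iff)
    show "card (insert v T) = Suc (card (nbrs E v))"
      using v Tsub fT cT by (metis card_insert_disjoint in_mono)
  qed
qed

lemma longest_cycle_exists:
  assumes G: "simple_graph n E" and "is_cycle E ws"
  obtains vs where "longest_cycle E vs" "length ws \<le> length vs" "set vs \<subseteq> {..<n}"
proof -
  have sub: "set vs \<subseteq> {..<n}" if "is_cycle E vs" for vs
  proof
    fix x assume "x \<in> set vs"
    then obtain i where "i < length vs" "x = vs ! i" by (auto simp: in_set_conv_nth)
    then show "x \<in> {..<n}" using that adjD(1)[OF G] by (auto simp: is_cycle_def adj_def)
  qed
  have "length vs < Suc n" if "is_cycle E vs" for vs
    using card_mono[OF _ sub[OF that]] that by (simp add: is_cycle_def distinct_card)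
  then obtain vs where "is_cycle E vs" "\<forall>ws. is_cycle E ws \<longrightarrow> length ws \<le> length vs"
    using ex_has_greatest_nat[of "is_cycle E" ws length "Suc n"] assms(2) by auto
  then show ?thesis using that sub assms(2) by (auto simp: longest_cycle_def)
qed

theorem hamiltonian_if_long_cycle_and_small_stable:
  assumes G: "simple_graph n E" and deg: "\<And>v. v < n \<Longrightarrow> d \<le> card (nbrs E v)"
    and ws: "is_cycle E ws" and long: "3 * n < 2 * length ws + 3 * d + 3"
    and ind: "\<And>S. S \<subseteq> {..<n} \<Longrightarrow> stable E S \<Longrightarrow> card S \<le> d"
  shows "hamiltonian n E"
proof -
  obtain vs where vs: "longest_cycle E vs" "length ws \<le> length vs" "set vs \<subseteq> {..<n}"
    using longest_cycle_exists[OF G ws] .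
  have out: "stable E ({..<n} - set vs)"
    using outside_longest_cycle_stable[OF G vs(1,3) deg] long vs(2) by linarith
  have "set vs = {..<n}"
  proof (rule ccontr)
    assume "set vs \<noteq> {..<n}"
    then obtain v where v: "v < n" "v \<notin> set vs" using vs(3) by auto
    \<comment> \<open>The complement of the cycle is stable, so all edges at \<open>v\<close> go to
      the cycle.\<close>
    have "nbrs E v \<subseteq> set vs"
      using out v nbrs_subset[OF G, of v] unfolding stable_def by fastforce
    then obtain S where "S \<subseteq> {..<n}" "stable E S" "card S = Suc (card (nbrs E v))"
      using longest_cycle_stable_set[OF G vs(1,3) v] by blast
    then show False using ind[of S] deg[OF v(1)] by simp
  qed
  then show ?thesis using vs(1) by (auto simp: hamiltonian_def longest_cycle_def)
qed

section \<open>A long cycle or two dense clusters\<close>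

lemma not_adj_self: "simple_graph n E \<Longrightarrow> \<not> adj E x x"
  using adjD(3) by blast

definition longest_path :: "nat \<Rightarrow> nat set set \<Rightarrow> nat list \<Rightarrow> bool" where
  "longest_path n E P \<longleftrightarrow> P \<noteq> [] \<and> distinct P \<and> set P \<subseteq> {..<n} \<and> successively (adj E) P \<and>
     (\<forall>Q. distinct Q \<and> set Q \<subseteq> {..<n} \<and> successively (adj E) Q \<longrightarrow> length Q \<le> length P)"

text \<open>The inequalities say that each vertex misses at most \<open>n - 2d\<close> vertices of its own side, arranged so
  that no truncated subtraction occurs.\<close>

definition splits :: "nat \<Rightarrow> nat \<Rightarrow> nat set set \<Rightarrow> nat set \<Rightarrow> nat set \<Rightarrow> bool" where
  "splits n d E A B \<longleftrightarrow> A \<subseteq> {..<n} \<and> B \<subseteq> {..<n} \<and> A \<inter> B = {} \<and> d \<le> card A \<and> d \<le> card B \<and>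
     (\<forall>v\<in>A. card A + 2 * d \<le> card (nbrs E v \<inter> A) + n) \<and>
     (\<forall>v\<in>B. card B + 2 * d \<le> card (nbrs E v \<inter> B) + n)"

definition long_cycle_or_split :: "nat \<Rightarrow> nat \<Rightarrow> nat set set \<Rightarrow> bool" where
  "long_cycle_or_split n d E \<longleftrightarrow>
     (\<exists>vs. is_cycle E vs \<and> 2 * d \<le> length vs) \<or> (\<exists>A B. splits n d E A B)"

lemma longest_pathD:
  "longest_path n E P \<Longrightarrow> distinct Q \<Longrightarrow> set Q \<subseteq> {..<n} \<Longrightarrow> successively (adj E) Q \<Longrightarrow> length Q \<le> length P"
  by (simp add: longest_path_def)

lemma longest_path_exists:
  assumes "n > 0"
  obtains P where "longest_path n E P"
proof -
  let ?R = "\<lambda>Q. distinct Q \<and> set Q \<subseteq> {..<n} \<and> successively (adj E) Q"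
  have b: "length Q < Suc n" if "?R Q" for Q
    using that card_mono[of "{..<n}" "set Q"] by (simp add: distinct_card)
  obtain P where P: "?R P" "\<forall>Q. ?R Q \<longrightarrow> length Q \<le> length P"
    using ex_has_greatest_nat[of ?R "[0]" length "Suc n"] b assms by auto
  have "length [0::nat] \<le> length P"
    using P(2)[rule_format, of "[0]"] assms by simp
  then have "P \<noteq> []" by auto
  then show ?thesis using that[of P] P by (simp add: longest_path_def)
qed

lemma longest_path_rev: "longest_path n E P \<Longrightarrow> longest_path n E (rev P)"
  unfolding longest_path_def by (auto simp del: successively_rev)

section \<open>Chords at the ends of a longest path\<close>

lemma nbrs_hd_longest_path:
  assumes G: "simple_graph n E" and P: "longest_path n E P"
  shows "nbrs E (hd P) \<subseteq> set P"
proof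
  fix x assume x: "x \<in> nbrs E (hd P)"
  show "x \<in> set P"
  proof (rule ccontr)
    assume "x \<notin> set P"
    moreover have "adj E x (hd P)" "x < n"
      using x adjD(2)[OF G] by (simp_all add: adj_sym[of E x])
    ultimately have "length (x # P) \<le> length P"
      using P by (intro longest_pathD[OF P]) (auto simp: longest_path_def successively_Cons)
    then show False by simp
  qed
qed

lemma nbrs_last_longest_path:
  assumes "simple_graph n E" "longest_path n E P"
  shows "nbrs E (last P) \<subseteq> set P"
  using nbrs_hd_longest_path[OF assms(1) longest_path_rev[OF assms(2)]] by (simp add: hd_rev)

text \<open>The two chords close the path into a cycle on the same vertices. An edge leaving it
  would give a longer path. So the cycle spans, or no edge joins \<open>set P\<close> to its
  complement; then both parts have at least \<open>d\<close> vertices and inner degrees at least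
  \<open>d\<close>, which is a split.\<close>

lemma longest_path_crossing:
  assumes G: "simple_graph n E" and deg: "\<And>v. v < n \<Longrightarrow> d \<le> card (nbrs E v)"
    and d: "2 \<le> d" "2 * d \<le> n"
    and P: "longest_path n E P" and i: "Suc i < length P"
    and ends: "adj E (hd P) (P ! Suc i)" "adj E (last P) (P ! i)"
  shows "long_cycle_or_split n d E"
proof -
  have P': "P \<noteq> []" "distinct P" "set P \<subseteq> {..<n}" "successively (adj E) P"
    using P by (auto simp: longest_path_def)
  have hdn: "hd P < n" using P' by (metis hd_in_set lessThan_iff subsetD)
  have "hd P \<in> set P - nbrs E (hd P)" using P'(1) by (simp add: not_adj_self[OF G])
  then have "card (nbrs E (hd P)) < card (set P)"
    using nbrs_hd_longest_path[OF G P] by (intro psubset_card_mono) auto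
  then have dP: "d < card (set P)" using deg[OF hdn] by linarith
  then have l3: "3 \<le> length P" using d P' by (simp add: distinct_card)
  \<comment> \<open>Walk to \<open>P ! i\<close>, jump to the last vertex, walk back to
    \<open>P ! Suc i\<close> and return to the head.\<close>
  define C where "C = take (Suc i) P @ rev (drop (Suc i) P)"
  have split: "P = take (Suc i) P @ drop (Suc i) P" by simp
  have succ: "successively (adj E) (take (Suc i) P)" "successively (adj E) (drop (Suc i) P)"
    using P'(4) split by (metis successively_append_iff)+
  have dis: "set (take (Suc i) P) \<inter> set (drop (Suc i) P) = {}"
    using P'(2) by (simp add: set_take_disj_set_drop_if_distinct)
  have ne: "take (Suc i) P \<noteq> []" "drop (Suc i) P \<noteq> []" using P'(1) i by auto
  have C: "is_cycle E C"
    unfolding C_def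
  proof (rule is_cycle_appendI)
    show "adj E (last (take (Suc i) P)) (hd (rev (drop (Suc i) P)))"
      using ends(2) i by (simp add: hd_rev take_Suc_conv_app_nth adj_sym[of E "P ! i"])
    show "adj E (last (rev (drop (Suc i) P))) (hd (take (Suc i) P))"
      using ends(1) i by (simp add: last_rev hd_drop_conv_nth adj_sym[of E "P ! Suc i"])
  qed (use P' dis succ ne l3 in \<open>simp_all del: successively_rev\<close>)
  have lC: "length C = length P" using i by (simp add: C_def)
  have sC: "set C = set P"
    unfolding C_def by (metis set_append set_rev split)
  have closed: "y \<in> set P" if x: "x \<in> set P" and xy: "adj E x y" for x y
  proof (rule ccontr)
    assume y: "y \<notin> set P"
    obtain k where k: "k < length C" "C ! k = x"
      using x sC by (metis in_set_conv_nth)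
    obtain ws where ws: "is_cycle E ws" "length ws = length C" "set ws = set C" "last ws = x"
      using cycle_rotation_at[OF C k(1)] k(2) by metis
    have "length (ws @ [y]) \<le> length P"
      using ws xy y sC P'(3) adjD(2)[OF G xy]
      by (intro longest_pathD[OF P]) (auto simp: is_cycle_iff successively_append_iff)
    then show False using ws(2) lC by simp
  qed
  show ?thesis
  proof (cases "set P = {..<n}")
    case True
    then have "length C = n" using P'(2) lC by (metis card_lessThan distinct_card)
    then show ?thesis using C d by (auto simp: long_cycle_or_split_def)
  next
    case False
    define A where "A = set P"
    define B where "B = {..<n} - A"
    have AB: "card A + card B = n"
      using P'(3) by (simp add: A_def B_def card_Diff_subset card_mono[of "{..<n}", simplified])
    have cA: "nbrs E v \<subseteq> A" if "v \<in> A" for v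
      using closed that by (auto simp: A_def)
    have cB: "nbrs E v \<subseteq> B" if "v \<in> B" for v
      using closed that nbrs_subset[OF G, of v] adj_sym[of E] by (fastforce simp: A_def B_def)
    obtain y where y: "y \<in> B" using False P'(3) by (auto simp: A_def B_def)
    have dB: "d \<le> card B"
      using deg[of y] card_mono[OF _ cB[OF y]] y by (auto simp: B_def)
    have "splits n d E A B"
      unfolding splits_def
    proof (intro conjI ballI)
      fix v assume v: "v \<in> A"
      then have "d \<le> card (nbrs E v \<inter> A)"
        using deg[of v] cA P'(3) by (auto simp: A_def Int_absorb2)
      then show "card A + 2 * d \<le> card (nbrs E v \<inter> A) + n" using dB AB by linarith
    next
      fix v assume v: "v \<in> B"
      then have "d \<le> card (nbrs E v \<inter> B)"
        using deg[of v] cB by (auto simp: B_def Int_absorb2)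
      then show "card B + 2 * d \<le> card (nbrs E v \<inter> B) + n" using dP[folded A_def] AB by linarith
    qed (use P' dB dP in \<open>auto simp: A_def B_def\<close>)
    then show ?thesis by (auto simp: long_cycle_or_split_def)
  qed
qed

text \<open>Positions are shifted down by one so that a common member with the corresponding set for
  the last vertex is exactly a pair of crossing chords.\<close>

lemma card_hd_nbr_indices:
  assumes G: "simple_graph n E" and P: "longest_path n E P"
  shows "card {k. Suc k < length P \<and> adj E (hd P) (P ! Suc k)} = card (nbrs E (hd P))"
proof -
  have P': "P \<noteq> []" "distinct P" using P by (auto simp: longest_path_def)
  have "bij_betw Suc {k. Suc k < length P \<and> adj E (hd P) (P ! Suc k)}
          {k. k < length P \<and> P ! k \<in> nbrs E (hd P)}"
  proof (rule bij_betwI')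
    fix k assume "k \<in> {k. k < length P \<and> P ! k \<in> nbrs E (hd P)}"
    moreover from this have "k \<noteq> 0" using P'(1) not_adj_self[OF G, of "P ! 0"] by (cases k) (auto simp: hd_conv_nth)
    ultimately show "\<exists>k'\<in>{k. Suc k < length P \<and> adj E (hd P) (P ! Suc k)}. k = Suc k'"
      by (cases k) auto
  qed auto
  then have "card {k. Suc k < length P \<and> adj E (hd P) (P ! Suc k)} = card (nbrs E (hd P) \<inter> set P)"
    unfolding card_index_set[OF P'(2), symmetric] by (rule bij_betw_same_card)
  then show ?thesis using nbrs_hd_longest_path[OF G P] by (simp add: Int_absorb2)
qed

lemma card_last_nbr_indices:
  assumes G: "simple_graph n E" and P: "longest_path n E P"
  shows "card {k. Suc k < length P \<and> adj E (last P) (P ! k)} = card (nbrs E (last P))"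
proof -
  have P': "P \<noteq> []" "distinct P" using P by (auto simp: longest_path_def)
  have "Suc k < length P" if "k < length P" "adj E (last P) (P ! k)" for k
  proof -
    have "k \<noteq> length P - 1" using that adjD(3)[OF G] P'(1) by (auto simp: last_conv_nth)
    then show ?thesis using that by linarith
  qed
  then have "{k. Suc k < length P \<and> adj E (last P) (P ! k)} = {k. k < length P \<and> P ! k \<in> nbrs E (last P)}"
    by auto
  then show ?thesis
    using card_index_set[OF P'(2), of "nbrs E (last P)"] nbrs_last_longest_path[OF G P] by (simp add: Int_absorb2)
qed

text \<open>The induction on \<open>j - i\<close> replaces the choice of a closest pair: no
  neighbour of either end lies strictly between \<open>i\<close> and \<open>j\<close>. If no chords
  cross as in the previous lemma, \<open>X\<close> and \<open>Y\<close> are disjoint and avoid the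
  gap. Their total size of at least \<open>2 * d\<close> then bounds from below the length of the
  cycle that skips the gap.\<close>

lemma longest_path_overlap:
  assumes G: "simple_graph n E" and deg: "\<And>v. v < n \<Longrightarrow> d \<le> card (nbrs E v)"
    and d: "2 \<le> d" "2 * d \<le> n"
    and P: "longest_path n E P" and ij: "i < j" "j < length P"
    and ends: "adj E (hd P) (P ! j)" "adj E (last P) (P ! i)"
  shows "long_cycle_or_split n d E"
  using ij ends
proof (induction "j - i" arbitrary: i j rule: less_induct)
  case less
  have P': "P \<noteq> []" "distinct P" "set P \<subseteq> {..<n}" "successively (adj E) P"
    using P by (auto simp: longest_path_def)
  define X where "X = {k. Suc k < length P \<and> adj E (hd P) (P ! Suc k)}"
  define Y where "Y = {k. Suc k < length P \<and> adj E (last P) (P ! k)}"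
  show ?case
  proof (cases "(\<exists>k. i < k \<and> k < j \<and> (adj E (hd P) (P ! k) \<or> adj E (last P) (P ! k))) \<or> X \<inter> Y \<noteq> {}")
    case True
    then consider k where "i < k" "k < j" "adj E (hd P) (P ! k)"
      | k where "i < k" "k < j" "adj E (last P) (P ! k)" | k where "k \<in> X" "k \<in> Y" by blast
    then show ?thesis
    proof cases
      case 1
      then show ?thesis using less.hyps[of k i] less.prems by auto
    next
      case 2
      then show ?thesis using less.hyps[of j k] less.prems by auto
    next
      case 3
      then show ?thesis using longest_path_crossing[OF G deg d P, of k] by (auto simp: X_def Y_def)
    qed
  next
    case False
    \<comment> \<open>\<open>X\<close> is shifted by one against the neighbours of the head, so the
      range avoided by both sets stops one short of the end of the gap.\<close>
    have XY: "X \<union> Y \<subseteq> {..<length P - 1} - {Suc i..<j - 1}"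
      using False by (fastforce simp: X_def Y_def)
    have fin: "finite X" "finite Y" using XY by (auto intro: finite_subset)
    have hl: "hd P < n" "last P < n"
      using P' by (metis hd_in_set lessThan_iff subsetD, metis last_in_set lessThan_iff subsetD)
    have "2 * d \<le> card X + card Y"
      using deg[OF hl(1)] deg[OF hl(2)] card_hd_nbr_indices[OF G P] card_last_nbr_indices[OF G P]
      unfolding X_def Y_def by linarith
    also have "\<dots> = card (X \<union> Y)" using False fin by (simp add: card_Un_disjoint)
    also have "\<dots> \<le> card ({..<length P - 1} - {Suc i..<j - 1})"
      using XY by (intro card_mono) auto
    also have "\<dots> = length P - 1 - (j - 1 - Suc i)"
      using less.prems by (subst card_Diff_subset) auto
    also have "\<dots> \<le> Suc i + (length P - j)" using less.prems by linarith
    finally have len: "2 * d \<le> Suc i + (length P - j)" .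
    have succ: "successively (adj E) (take (Suc i) P)" "successively (adj E) (drop j P)"
      using P'(4) by (metis append_take_drop_id successively_append_iff)+
    have dis: "set (take (Suc i) P) \<inter> set (drop j P) = {}"
      using P'(2) less.prems by (simp add: set_take_disj_set_drop_if_distinct)
    have "is_cycle E (take (Suc i) P @ rev (drop j P))"
    proof (rule is_cycle_appendI)
      show "adj E (last (take (Suc i) P)) (hd (rev (drop j P)))"
        using less.prems by (simp add: hd_rev take_Suc_conv_app_nth adj_sym[of E "P ! i"])
      show "adj E (last (rev (drop j P))) (hd (take (Suc i) P))"
        using less.prems by (simp add: last_rev hd_drop_conv_nth adj_sym[of E "P ! j"])
      show "3 \<le> length (take (Suc i) P) + length (rev (drop j P))"
        using len d less.prems by simp
    qed (use P' dis succ less.prems in \<open>simp_all del: successively_rev\<close>)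
    then show ?thesis using len less.prems unfolding long_cycle_or_split_def
      by (intro disjI1 exI[of _ "take (Suc i) P @ rev (drop j P)"]) simp
  qed
qed

text \<open>Posa's rotation: a chord at the head allows the initial segment to be reversed, so that
  \<open>P ! a\<close> becomes the head while the last vertex stays.\<close>

lemma longest_path_rotate:
  assumes P: "longest_path n E P" and a: "Suc a < length P" "adj E (hd P) (P ! Suc a)"
  shows "longest_path n E (rev (take (Suc a) P) @ drop (Suc a) P)"
proof -
  let ?Q = "rev (take (Suc a) P) @ drop (Suc a) P"
  have P': "P \<noteq> []" "distinct P" "set P \<subseteq> {..<n}" "successively (adj E) P"
    using P by (auto simp: longest_path_def)
  have succ: "successively (adj E) (take (Suc a) P)" "successively (adj E) (drop (Suc a) P)"
    using P'(4) by (metis append_take_drop_id successively_append_iff)+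
  have "distinct ?Q" using P'(2) by (simp add: set_take_disj_set_drop_if_distinct)
  moreover have "set ?Q = set P" by (metis append_take_drop_id set_append set_rev)
  moreover have "length ?Q = length P" using a by simp
  moreover have "successively (adj E) ?Q"
    using succ a by (simp add: successively_append_iff last_rev hd_drop_conv_nth del: successively_rev)
  ultimately show ?thesis using P unfolding longest_path_def by (metis length_0_conv)
qed

text \<open>The members of \<open>A\<close> are the heads obtained by one rotation. With
  \<open>i\<close> the first position of a neighbour of the last vertex, the overlap lemma confines
  the neighbours of each such head to the set \<open>W\<close> of the first \<open>i + 1\<close>
  vertices. Since \<open>W\<close> contains \<open>A\<close> and has at most \<open>n - d\<close>
  vertices, each member of \<open>A\<close> misses at most \<open>n - 2 * d\<close> of
  \<open>A\<close>.\<close>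

lemma no_split_cluster_at_hd:
  assumes G: "simple_graph n E" and deg: "\<And>v. v < n \<Longrightarrow> d \<le> card (nbrs E v)"
    and d: "2 \<le> d" "2 * d \<le> n"
    and P: "longest_path n E P" and no: "\<not> long_cycle_or_split n d E"
  defines "A \<equiv> (!) P ` {a. Suc a < length P \<and> adj E (hd P) (P ! Suc a)}"
  shows "d \<le> card A" "\<And>v. v \<in> A \<Longrightarrow> card A + 2 * d \<le> card (nbrs E v \<inter> A) + n"
proof -
  have P': "P \<noteq> []" "distinct P" "set P \<subseteq> {..<n}" "successively (adj E) P"
    using P by (auto simp: longest_path_def)
  have hl: "hd P < n" "last P < n"
    using P' by (metis hd_in_set lessThan_iff subsetD, metis last_in_set lessThan_iff subsetD)
  define X where "X = {a. Suc a < length P \<and> adj E (hd P) (P ! Suc a)}"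
  define Y where "Y = {k. Suc k < length P \<and> adj E (last P) (P ! k)}"
  have "inj_on ((!) P) X" using P'(2) by (auto simp: inj_on_def X_def nth_eq_iff_index_eq)
  then have "card A = card (nbrs E (hd P))"
    using card_hd_nbr_indices[OF G P] by (simp add: A_def X_def card_image)
  then show dA: "d \<le> card A" using deg[OF hl(1)] by simp
  have dY: "d \<le> card Y" using card_last_nbr_indices[OF G P] deg[OF hl(2)] by (simp add: Y_def)
  have finY: "finite Y" by (rule finite_subset[of _ "{..<length P}"]) (auto simp: Y_def)
  have Yne: "Y \<noteq> {}" using dY d by auto
  define i where "i = Min Y"
  have iY: "i \<in> Y" unfolding i_def by (rule Min_in[OF finY Yne])
  \<comment> \<open>At least \<open>d\<close> neighbours of the last vertex sit at positions
    \<open>i\<close> to \<open>length P - 2\<close>, which keeps \<open>i\<close> small.\<close>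
  have "Y \<subseteq> {i..<length P - 1}" using finY by (auto simp: i_def Y_def)
  then have "card Y \<le> length P - 1 - i" using card_mono[of "{i..<length P - 1}" Y] by simp
  then have il: "Suc i + d \<le> length P" using dY d by linarith
  also have "length P \<le> n"
    using card_mono[OF _ P'(3)] P'(2) by (simp add: distinct_card)
  finally have iln: "Suc i + d \<le> n" .
  have ai: "Suc a \<le> i" if "a \<in> X" for a
    using longest_path_overlap[OF G deg d P, of i "Suc a"] no that iY by (force simp: X_def Y_def)
  define W where "W = set (take (Suc i) P)"
  have AW: "A \<subseteq> W"
  proof
    fix x assume "x \<in> A"
    then obtain a where "a \<in> X" "x = P ! a" by (auto simp: A_def X_def)
    then show "x \<in> W" using ai[of a] il by (auto simp: W_def in_set_conv_nth intro!: exI[of _ a])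
  qed
  have cW: "card W \<le> Suc i" unfolding W_def by (rule order_trans[OF card_length]) simp
  fix v assume v: "v \<in> A"
  then obtain a where a: "a \<in> X" "v = P ! a" by (auto simp: A_def X_def)
  have a': "Suc a < length P" "adj E (hd P) (P ! Suc a)" using a(1) by (simp_all add: X_def)
  let ?Q = "rev (take (Suc a) P) @ drop (Suc a) P"
  have Q: "longest_path n E ?Q" by (rule longest_path_rotate[OF P a'])
  have hQ: "hd ?Q = v" using a' a(2) by (simp add: take_Suc_conv_app_nth)
  have lQ: "last ?Q = last P" using a' by simp
  \<comment> \<open>The reversed segment ends before position \<open>i\<close>, so the rotation
    changes neither the vertex at \<open>i\<close> nor the set of the first \<open>i + 1\<close>
    vertices.\<close>
  have Qi: "?Q ! i = P ! i"
    using ai[OF a(1)] il a' by (simp add: nth_append)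
  have take_eq: "set (take (Suc i) ?Q) = W"
  proof -
    have "take (Suc i) P = take (Suc a) P @ take (i - a) (drop (Suc a) P)"
      using ai[OF a(1)] take_add[of "Suc a" "i - a" P] by simp
    moreover have "take (Suc i) ?Q = rev (take (Suc a) P) @ take (i - a) (drop (Suc a) P)"
      using ai[OF a(1)] a' by simp
    ultimately show ?thesis unfolding W_def by (metis set_append set_rev)
  qed
  have NW: "nbrs E v \<subseteq> W"
  proof
    fix u assume u: "u \<in> nbrs E v"
    then have "u \<in> set ?Q" using nbrs_hd_longest_path[OF G Q] hQ by auto
    then obtain k where k: "k < length ?Q" "u = ?Q ! k" by (metis in_set_conv_nth)
    have "\<not> i < k"
    proof
      assume "i < k"
      then have "long_cycle_or_split n d E"
        using longest_path_overlap[OF G deg d Q, of i k] k u hQ lQ Qi iY by (simp add: Y_def)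
      then show False using no by blast
    qed
    then show "u \<in> W" using k unfolding take_eq[symmetric]
      by (metis in_set_conv_nth length_take less_Suc_eq_le min_less_iff_conj not_le_imp_less nth_take)
  qed
  have "v < n" using a a' P'(3) by (metis Suc_lessD lessThan_iff nth_mem subsetD)
  then have "d \<le> card (nbrs E v)" by (rule deg)
  also have "\<dots> \<le> card ((nbrs E v \<inter> A) \<union> (W - A))"
    using NW finite_nbrs[OF G] by (intro card_mono) (auto simp: W_def)
  also have "\<dots> \<le> card (nbrs E v \<inter> A) + card (W - A)" by (rule card_Un_le)
  also have "card (W - A) = card W - card A"
    using AW by (intro card_Diff_subset) (auto simp: W_def intro: finite_subset)
  finally have "d \<le> card (nbrs E v \<inter> A) + (card W - card A)" .
  moreover have "card A \<le> card W" using AW by (intro card_mono) (auto simp: W_def)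
  ultimately show "card A + 2 * d \<le> card (nbrs E v \<inter> A) + n"
    using cW iln by linarith
qed

text \<open>Rotations at the head and, by reversal, at the other end give two clusters. For a common
  vertex \<open>P ! a\<close>, the successor would be adjacent to the head and the predecessor to
  the last vertex, which is an overlap.\<close>

theorem long_cycle_or_split:
  assumes G: "simple_graph n E" and deg: "\<And>v. v < n \<Longrightarrow> d \<le> card (nbrs E v)"
    and d: "2 \<le> d" "2 * d \<le> n"
  shows "long_cycle_or_split n d E"
proof (rule ccontr)
  assume no: "\<not> long_cycle_or_split n d E"
  obtain P where P: "longest_path n E P" using longest_path_exists[of n E] d by auto
  have P': "P \<noteq> []" "distinct P" "set P \<subseteq> {..<n}" using P by (auto simp: longest_path_def)
  define A where "A = (!) P ` {a. Suc a < length P \<and> adj E (hd P) (P ! Suc a)}"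
  define B where "B = (!) (rev P) ` {a. Suc a < length (rev P) \<and> adj E (hd (rev P)) (rev P ! Suc a)}"
  have "A \<inter> B = {}"
  proof (rule ccontr)
    assume "A \<inter> B \<noteq> {}"
    then obtain a b where a: "Suc a < length P" "adj E (hd P) (P ! Suc a)"
      and b: "Suc b < length P" "adj E (last P) (rev P ! Suc b)" and eq: "P ! a = rev P ! b"
      by (auto simp: A_def B_def hd_rev)
    have "rev P ! b = P ! (length P - Suc b)" using b by (simp add: rev_nth)
    then have "a = length P - Suc b"
      using eq a b P'(2) by (simp add: nth_eq_iff_index_eq)
    moreover have "rev P ! Suc b = P ! (length P - Suc (Suc b))" using b by (simp add: rev_nth)
    ultimately have "adj E (last P) (P ! (a - 1))" using b(2) by (simp add: diff_Suc)
    then show False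
      using longest_path_overlap[OF G deg d P, of "a - 1" "Suc a"] a no by (simp add: less_Suc_eq_le)
  qed
  moreover have "A \<subseteq> set P" "B \<subseteq> set (rev P)"
    unfolding A_def B_def by (auto simp del: set_rev)
  ultimately have "splits n d E A B"
    using no_split_cluster_at_hd[OF G deg d P no] P'(3)
      no_split_cluster_at_hd[OF G deg d longest_path_rev[OF P] no]
    unfolding splits_def A_def[symmetric] B_def[symmetric] by auto
  then show False using no by (auto simp: long_cycle_or_split_def)
qed

section \<open>Matchings that force a Hamilton cycle\<close>

text \<open>A path is grown greedily from \<open>a\<close>, avoiding \<open>b\<close>, until
  \<open>2 * k + 1\<close> vertices of \<open>A\<close> are left. Its end and \<open>b\<close> each
  miss at most \<open>k\<close> vertices of \<open>A\<close>, so they have at least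
  \<open>card A - 2 * k\<close> common neighbours; one of these is off the path and links the
  two.\<close>

lemma near_complete_path:
  assumes G: "simple_graph n E" and A: "finite A" "a \<in> A" "b \<in> A" "a \<noteq> b"
    and deg: "\<And>v. v \<in> A \<Longrightarrow> card A \<le> card (nbrs E v \<inter> A) + k" and k: "2 * k + 2 \<le> card A"
  obtains P where "P \<noteq> []" "hd P = a" "last P = b" "distinct P" "set P \<subseteq> A" "successively (adj E) P"
    "card A \<le> length P + 2 * k"
proof -
  have step: "\<exists>P. length P = t \<and> distinct P \<and> set P \<subseteq> A - {b} \<and> hd P = a \<and> successively (adj E) P"
    if "1 \<le> t" "t + 2 * k + 1 \<le> card A" for t
    using that
  proof (induction t rule: nat_induct_at_least)
    case base
    then show ?case using A by (intro exI[of _ "[a]"]) auto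
  next
    case (Suc t)
    then obtain P where P: "length P = t" "distinct P" "set P \<subseteq> A - {b}" "hd P = a" "successively (adj E) P"
      by auto
    have ne: "P \<noteq> []" using P(1) Suc.hyps by auto
    have x: "last P \<in> A" using P(3) ne last_in_set by blast
    have "card (insert b (set P)) \<le> Suc t"
      using P(1,2) by (metis card_insert_le_m1 diff_Suc_1 distinct_card order_refl zero_less_Suc)
    also have "\<dots> < card (nbrs E (last P) \<inter> A)" using deg[OF x] Suc.prems by linarith
    finally have "\<not> nbrs E (last P) \<inter> A \<subseteq> insert b (set P)"
      using card_mono[of "insert b (set P)"] by (meson List.finite_set finite.insertI leD)
    then obtain y where y: "adj E (last P) y" "y \<in> A" "y \<noteq> b" "y \<notin> set P" by fastforce
    have "hd (P @ [y]) = a" using P(4) ne by simp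
    then show ?case using P y by (intro exI[of _ "P @ [y]"]) (auto simp: successively_append_iff)
  qed
  obtain P where P: "length P = card A - 2 * k - 1" "distinct P" "set P \<subseteq> A - {b}" "hd P = a" "successively (adj E) P"
  proof -
    have "1 \<le> card A - 2 * k - 1" "card A - 2 * k - 1 + 2 * k + 1 \<le> card A" using k by linarith+
    from step[OF this] show ?thesis using that by blast
  qed
  have ne: "P \<noteq> []" using P(1) k by auto
  have x: "last P \<in> A" using P(3) ne last_in_set by blast
  let ?X = "nbrs E (last P) \<inter> A" and ?Y = "nbrs E b \<inter> A"
  have "card ?X + card ?Y = card (?X \<union> ?Y) + card (?X \<inter> ?Y)"
    using A(1) by (intro card_Un_Int) auto
  moreover have "card (?X \<union> ?Y) \<le> card A" using A(1) by (intro card_mono) auto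
  ultimately have "card A \<le> card (?X \<inter> ?Y) + 2 * k" using deg[OF x] deg[OF A(3)] by linarith
  then have "card (set P) < card (?X \<inter> ?Y)" using P(1,2) k by (simp add: distinct_card)
  then have "\<not> ?X \<inter> ?Y \<subseteq> set P" using card_mono[of "set P"] by (meson List.finite_set leD)
  then obtain z where z: "adj E (last P) z" "adj E b z" "z \<in> A" "z \<notin> set P" by fastforce
  have zb: "z \<noteq> b" using z(2) not_adj_self[OF G] by auto
  show ?thesis
  proof
    show "hd (P @ [z, b]) = a" using P(4) ne by simp
    show "successively (adj E) (P @ [z, b])"
      using P(5) z(1) z(2) by (simp add: successively_append_iff adj_sym[of E z])
    show "distinct (P @ [z, b])" "set (P @ [z, b]) \<subseteq> A" using P z zb A by auto
  qed (use P(1) in auto)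
qed

definition has_matching :: "nat \<Rightarrow> nat set set \<Rightarrow> bool" where
  "has_matching k E \<longleftrightarrow> (\<exists>M\<subseteq>E. finite M \<and> pairwise disjnt M \<and> k \<le> card M)"

definition edges_between :: "nat set \<Rightarrow> nat set \<Rightarrow> nat set set" where
  "edges_between A B = (\<lambda>(a, b). {a, b}) ` (A \<times> B)"

lemma card_edges_between:
  assumes "A \<inter> B = {}"
  shows "card (edges_between A B) = card A * card B"
proof -
  have "inj_on (\<lambda>(a, b). {a, b}) (A \<times> B)"
    using assms by (auto simp: inj_on_def doubleton_eq_iff)
  then show ?thesis by (simp add: edges_between_def card_image card_cartesian_product)
qed

lemma edges_between_subset:
  "A \<subseteq> {..<n} \<Longrightarrow> B \<subseteq> {..<n} \<Longrightarrow> A \<inter> B = {} \<Longrightarrow> edges_between A B \<subseteq> potential_edges n"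
  by (auto simp: edges_between_def potential_edges_iff)

lemma nbrs_mono: "E \<subseteq> E' \<Longrightarrow> nbrs E v \<subseteq> nbrs E' v"
  by (auto simp: adj_def)

text \<open>A path inside \<open>A\<close> and a path inside \<open>B\<close> join the ends of two
  disjoint crossing edges; each path omits at most \<open>2 * k\<close> vertices of its
  side.\<close>

lemma splits_matching_cycle:
  assumes G: "simple_graph n E" and G': "simple_graph n R" and AB: "splits n d E A B"
    and k: "2 * d + k = n" "2 * k + 2 \<le> d"
    and M: "has_matching 2 (R \<inter> edges_between A B)"
  obtains vs where "is_cycle (E \<union> R) vs" "2 * d \<le> length vs + 4 * k"
proof -
  have sp: "A \<subseteq> {..<n}" "B \<subseteq> {..<n}" "A \<inter> B = {}" "d \<le> card A" "d \<le> card B"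
     "\<And>v. v \<in> A \<Longrightarrow> card A + 2 * d \<le> card (nbrs E v \<inter> A) + n"
     "\<And>v. v \<in> B \<Longrightarrow> card B + 2 * d \<le> card (nbrs E v \<inter> B) + n"
    using AB by (auto simp: splits_def)
  have fin: "finite A" "finite B" using sp by (auto intro: finite_subset)
  have GG: "simple_graph n (E \<union> R)" using G G' by (simp add: simple_graph_def)
  have cA: "card A \<le> card (nbrs (E \<union> R) v \<inter> A) + k" if "v \<in> A" for v
  proof -
    have "card (nbrs E v \<inter> A) \<le> card (nbrs (E \<union> R) v \<inter> A)"
      using fin nbrs_mono[of E "E \<union> R" v] by (intro card_mono) auto
    then show ?thesis using sp(6)[OF that] k by linarith
  qed
  have cB: "card B \<le> card (nbrs (E \<union> R) v \<inter> B) + k" if "v \<in> B" for v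
  proof -
    have "card (nbrs E v \<inter> B) \<le> card (nbrs (E \<union> R) v \<inter> B)"
      using fin nbrs_mono[of E "E \<union> R" v] by (intro card_mono) auto
    then show ?thesis using sp(7)[OF that] k by linarith
  qed
  obtain M where M: "M \<subseteq> R \<inter> edges_between A B" "pairwise disjnt M" "finite M" "2 \<le> card M"
    using M by (auto simp: has_matching_def)
  obtain e f where ef: "e \<in> M" "f \<in> M" "e \<noteq> f"
    using M(3,4) by (metis card_le_Suc0_iff_eq not_less_eq_eq numeral_2_eq_2)
  have dis: "e \<inter> f = {}" using M(2) ef by (auto simp: pairwise_def disjnt_def)
  have "\<exists>a\<in>A. \<exists>b\<in>B. x = {a, b}" if "x \<in> M" for x
  proof -
    have "x \<in> edges_between A B" using M(1) that by blast
    then show ?thesis by (auto simp: edges_between_def)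
  qed
  then obtain a b a' b' where e: "e = {a, b}" "a \<in> A" "b \<in> B" and f: "f = {a', b'}" "a' \<in> A" "b' \<in> B"
    using ef(1,2) by metis
  have ne: "a \<noteq> a'" "b' \<noteq> b" using dis e f by auto
  have ab: "adj (E \<union> R) b a" "adj (E \<union> R) a' b'"
    using M(1) ef(1,2) unfolding e(1) f(1) adj_def by (auto simp: insert_commute)
  obtain P where P: "P \<noteq> []" "hd P = a" "last P = a'" "distinct P" "set P \<subseteq> A" "successively (adj (E \<union> R)) P"
    "card A \<le> length P + 2 * k"
    using near_complete_path[OF GG fin(1) e(2) f(2) ne(1) cA] k sp(4) by auto
  obtain Q where Q: "Q \<noteq> []" "hd Q = b'" "last Q = b" "distinct Q" "set Q \<subseteq> B" "successively (adj (E \<union> R)) Q"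
    "card B \<le> length Q + 2 * k"
    using near_complete_path[OF GG fin(2) f(3) e(3) ne(2) cB] k sp(5) by auto
  have PQ: "2 * d \<le> length (P @ Q) + 4 * k" using P(7) Q(7) sp(4,5) by simp
  have "length P \<ge> 2" using P(1-3) ne(1) by (cases P; cases "tl P") auto
  moreover have "length Q \<ge> 2" using Q(1-3) ne(2) by (cases Q; cases "tl Q") auto
  moreover have "set P \<inter> set Q = {}" using P(5) Q(5) sp(3) by blast
  ultimately have "is_cycle (E \<union> R) (P @ Q)"
    using P Q ab by (intro is_cycle_appendI) simp_all
  then show ?thesis using that PQ by blast
qed

section \<open>Edge sets chosen independently of the random graph\<close>

lemma two_card_nsets_2: "2 * card (nsets S 2) = card S * (card S - 1)"
proof -
  have "even (card S * (card S - 1))" by (cases "card S") auto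
  then show ?thesis by (simp add: choose_two)
qed

text \<open>The bound is the number of pairs in a set of \<open>d + 1\<close> vertices.\<close>

definition many_edges :: "nat \<Rightarrow> nat \<Rightarrow> nat set set \<Rightarrow> bool" where
  "many_edges n d F \<longleftrightarrow> F \<subseteq> potential_edges n \<and> d * (d + 1) \<le> 2 * card F"

lemma many_edges_nsets:
  assumes "S \<subseteq> {..<n}" "d < card S"
  shows "many_edges n d (nsets S 2)"
proof -
  have "d * (d + 1) \<le> (card S - 1) * card S" using assms(2) by (intro mult_mono) auto
  then have "d * (d + 1) \<le> 2 * card (nsets S 2)"
    unfolding two_card_nsets_2 by (simp only: mult.commute)
  then show ?thesis
    using nsets_mono[OF assms(1)] unfolding many_edges_def potential_edges_def by blast
qed

lemma many_edges_potential: "d < n \<Longrightarrow> many_edges n d (potential_edges n)"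
  using many_edges_nsets[of "{..<n}" n d] by (simp add: potential_edges_def)

text \<open>\<open>F\<close> is fixed before \<open>R\<close>, because the probability of a matching
  is estimated for a fixed set of pairs. In the split case it consists of the pairs between the
  clusters, at least \<open>d * d\<close> in number.\<close>

lemma long_cycle_if_matching:
  assumes G: "simple_graph n H" and deg: "\<And>v. v < n \<Longrightarrow> d \<le> card (nbrs H v)"
    and d: "2 * d + k = n" "2 \<le> k" "2 * k + 2 \<le> d"
  shows "\<exists>F. many_edges n d F \<and> (\<forall>R. simple_graph n R \<and> has_matching k (R \<inter> F) \<longrightarrow>
    (\<exists>vs. is_cycle (H \<union> R) vs \<and> 2 * d \<le> length vs + 4 * k))"
proof -
  have "long_cycle_or_split n d H" using long_cycle_or_split[OF G deg] d by auto
  then consider vs where "is_cycle H vs" "2 * d \<le> length vs" | A B where "splits n d H A B"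
    by (auto simp: long_cycle_or_split_def)
  then show ?thesis
  proof cases
    case 1
    then have "is_cycle (H \<union> R) vs" for R by (auto simp: is_cycle_def)
    \<comment> \<open>\<open>H\<close> already has the cycle, so any sufficiently large set can
      serve as \<open>F\<close>.\<close>
    then show ?thesis using 1(2) many_edges_potential[of d n] d
      by (intro exI[of _ "potential_edges n"]) (auto intro!: exI[of _ vs])
  next
    case 2
    then have AB: "A \<subseteq> {..<n}" "B \<subseteq> {..<n}" "A \<inter> B = {}" "d \<le> card A" "d \<le> card B"
      by (auto simp: splits_def)
    have "d * (d + 1) \<le> 2 * (d * d)" using d by (cases d) auto
    also have "\<dots> \<le> 2 * card (edges_between A B)"
      using AB by (simp add: card_edges_between mult_mono)
    finally have "many_edges n d (edges_between A B)"
      using AB edges_between_subset by (simp add: many_edges_def)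
    moreover have "\<exists>vs. is_cycle (H \<union> R) vs \<and> 2 * d \<le> length vs + 4 * k"
      if "simple_graph n R" "has_matching k (R \<inter> edges_between A B)" for R
    proof -
      have "has_matching 2 (R \<inter> edges_between A B)"
        using that(2) d(2) unfolding has_matching_def by (meson order_trans)
      then show ?thesis using splits_matching_cycle[OF G that(1) 2 d(1,3)] by metis
    qed
    ultimately show ?thesis by blast
  qed
qed

text \<open>A common vertex has no \<open>H\<close>-neighbour in
  \<open>S \<union> S\<^sub>0\<close>, so this union has at most \<open>n - d\<close> vertices. Each
  of the \<open>k\<close> matching edges has an end in \<open>S\<^sub>0\<close> outside
  \<open>S\<close>, which leaves at most \<open>n - d - k = d\<close> vertices for
  \<open>S\<close>.\<close>

lemma stable_meeting_bound:
  assumes G: "simple_graph n H" and deg: "\<And>v. v < n \<Longrightarrow> d \<le> card (nbrs H v)" and d: "2 * d + k = n"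
    and S: "S\<^sub>0 \<subseteq> {..<n}" "stable H S\<^sub>0" "S \<subseteq> {..<n}" "stable (H \<union> R) S" "S \<inter> S\<^sub>0 \<noteq> {}"
    and M: "has_matching k (R \<inter> nsets S\<^sub>0 2)"
  shows "card S \<le> d"
proof -
  have fin: "finite S" "finite S\<^sub>0" using S by (auto intro: finite_subset)
  obtain v where v: "v \<in> S" "v \<in> S\<^sub>0" using S(5) by auto
  have "nbrs H v \<subseteq> {..<n} - (S \<union> S\<^sub>0)"
    using nbrs_subset[OF G, of v] S(2,4) v by (auto simp: stable_def adj_def)
  then have "card (nbrs H v) \<le> card ({..<n} - (S \<union> S\<^sub>0))" by (intro card_mono) auto
  also have "\<dots> = n - card (S \<union> S\<^sub>0)" using S(1,3) fin by (subst card_Diff_subset) auto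
  finally have "d \<le> n - card (S \<union> S\<^sub>0)" using deg[of v] S(3) v(1) by fastforce
  moreover have "card (S \<union> S\<^sub>0) \<le> n" using S card_mono[of "{..<n}" "S \<union> S\<^sub>0"] by simp
  ultimately have un: "card (S \<union> S\<^sub>0) + d \<le> n" by linarith
  obtain M where M: "M \<subseteq> R \<inter> nsets S\<^sub>0 2" "pairwise disjnt M" "finite M" "k \<le> card M"
    using M by (auto simp: has_matching_def)
  have "\<exists>x. x \<in> e - S" if "e \<in> M" for e
  proof -
    obtain x y where e: "e = {x, y}" using M(1) \<open>e \<in> M\<close> by (meson IntD2 nsets2_E subsetD)
    then have "adj (H \<union> R) x y" using that M(1) by (auto simp: adj_def)
    then show ?thesis using S(4) e by (auto simp: stable_def)
  qed
  then obtain f where f: "\<And>e. e \<in> M \<Longrightarrow> f e \<in> e - S" by metis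
  have "inj_on f M"
  proof (rule inj_onI, rule ccontr)
    fix e e' assume e: "e \<in> M" "e' \<in> M" "f e = f e'" "e \<noteq> e'"
    then have "e \<inter> e' = {}" using M(2) by (auto simp: pairwise_def disjnt_def)
    then show False using f[OF e(1)] f[OF e(2)] e(3) by auto
  qed
  moreover have "f ` M \<subseteq> S\<^sub>0 - S" using f M(1) by (fastforce simp: nsets_def)
  ultimately have "card M \<le> card (S\<^sub>0 - S)" using fin by (metis card_image card_mono finite_Diff)
  moreover have "card (S \<union> S\<^sub>0) = card S + card (S\<^sub>0 - S)"
    using fin card_Un_disjoint[of S "S\<^sub>0 - S"] by simp
  ultimately show ?thesis using un M(4) d by linarith
qed

text \<open>Two non-disjoint stable sets of size exceeding \<open>d\<close> differ little, and three pairwise disjoint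
  ones do not fit, so destroying one set or a disjoint pair of them destroys them all.\<close>

lemma small_stable_if_matching:
  assumes G: "simple_graph n H" and deg: "\<And>v. v < n \<Longrightarrow> d \<le> card (nbrs H v)"
    and d: "2 * d + k = n" "k \<le> d"
  shows "\<exists>F\<^sub>1 F\<^sub>2. many_edges n d F\<^sub>1 \<and> many_edges n d F\<^sub>2 \<and>
    (\<forall>R. has_matching k (R \<inter> F\<^sub>1) \<and> has_matching k (R \<inter> F\<^sub>2) \<longrightarrow>
      (\<forall>S. S \<subseteq> {..<n} \<and> stable (H \<union> R) S \<longrightarrow> card S \<le> d))"
proof (cases "n = 0")
  case True
  then show ?thesis using d by (auto simp: many_edges_def)
next
  case False
  let ?big = "\<lambda>S. S \<subseteq> {..<n} \<and> stable H S \<and> d < card S"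
  have dn: "d < n" using d False by linarith
  have mono: "stable H S" if "stable (H \<union> R) S" for R S
    using that by (auto simp: stable_def adj_def)
  have hit: "card S \<le> d"
    if "?big S\<^sub>0" "S \<subseteq> {..<n}" "stable (H \<union> R) S" "S \<inter> S\<^sub>0 \<noteq> {}" "has_matching k (R \<inter> nsets S\<^sub>0 2)" for S S\<^sub>0 R
    using stable_meeting_bound[OF G deg d(1), of S\<^sub>0 S R] that by auto
  show ?thesis
  proof (cases "\<exists>S. ?big S")
    case False
    then show ?thesis using many_edges_potential[OF dn] mono by (meson not_le_imp_less)
  next
    case True
    then obtain S\<^sub>0 where S0: "?big S\<^sub>0" by blast
    have F0: "many_edges n d (nsets S\<^sub>0 2)" using S0 many_edges_nsets by blast
    show ?thesis
    proof (cases "\<exists>S. ?big S \<and> S \<inter> S\<^sub>0 = {}")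
      case False
      then show ?thesis using F0 hit[OF S0] mono by (metis not_le_imp_less)
    next
      case True
      then obtain S\<^sub>1 where S1: "?big S\<^sub>1" "S\<^sub>1 \<inter> S\<^sub>0 = {}" by blast
      have F1: "many_edges n d (nsets S\<^sub>1 2)" using S1 many_edges_nsets by blast
      have "card S \<le> d"
        if S: "S \<subseteq> {..<n}" "stable (H \<union> R) S"
          and R: "has_matching k (R \<inter> nsets S\<^sub>0 2)" "has_matching k (R \<inter> nsets S\<^sub>1 2)" for R S
      proof (cases "S \<inter> S\<^sub>0 = {} \<and> S \<inter> S\<^sub>1 = {}")
        case False
        then show ?thesis using hit[OF S0 S _ R(1)] hit[OF S1(1) S _ R(2)] by blast
      next
        case True
        have fin: "finite S" "finite S\<^sub>0" "finite S\<^sub>1" using S S0 S1 by (auto intro: finite_subset)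
        \<comment> \<open>Three disjoint sets of more than \<open>d\<close> vertices would need
          \<open>3 * d + 3 \<le> 2 * d + k\<close>, against \<open>k \<le> d\<close>.\<close>
        have "card S + card S\<^sub>0 + card S\<^sub>1 = card (S \<union> S\<^sub>0 \<union> S\<^sub>1)"
          using True S1(2) fin by (subst card_Un_disjoint; force simp: card_Un_disjoint)
        also have "\<dots> \<le> n" using S S0 S1 card_mono[of "{..<n}" "S \<union> S\<^sub>0 \<union> S\<^sub>1"] by simp
        finally show ?thesis using S0 S1 d by linarith
      qed
      then show ?thesis using F0 F1 by blast
    qed
  qed
qed

theorem hamiltonian_if_matchings:
  assumes G: "simple_graph n H" and deg: "\<And>v. v < n \<Longrightarrow> d \<le> card (nbrs H v)"
    and d: "2 * d + k = n" "2 \<le> k" "11 * k \<le> d"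
  shows "\<exists>\<F>. finite \<F> \<and> card \<F> \<le> 3 \<and> (\<forall>F\<in>\<F>. many_edges n d F) \<and>
    (\<forall>R. simple_graph n R \<and> (\<forall>F\<in>\<F>. has_matching k (R \<inter> F)) \<longrightarrow> hamiltonian n (H \<union> R))"
proof -
  obtain F where F: "many_edges n d F" "\<And>R. simple_graph n R \<Longrightarrow> has_matching k (R \<inter> F) \<Longrightarrow>
    \<exists>vs. is_cycle (H \<union> R) vs \<and> 2 * d \<le> length vs + 4 * k"
    using long_cycle_if_matching[OF G deg d(1,2)] d by auto
  obtain F\<^sub>1 F\<^sub>2 where F12: "many_edges n d F\<^sub>1" "many_edges n d F\<^sub>2"
    "\<And>R S. has_matching k (R \<inter> F\<^sub>1) \<Longrightarrow> has_matching k (R \<inter> F\<^sub>2) \<Longrightarrow> S \<subseteq> {..<n} \<Longrightarrow> stable (H \<union> R) S \<Longrightarrow> card S \<le> d"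
    using small_stable_if_matching[OF G deg d(1)] d by auto
  have "hamiltonian n (H \<union> R)"
    if R: "simple_graph n R" "\<And>F'. F' \<in> {F, F\<^sub>1, F\<^sub>2} \<Longrightarrow> has_matching k (R \<inter> F')" for R
  proof -
    obtain vs where vs: "is_cycle (H \<union> R) vs" "2 * d \<le> length vs + 4 * k"
      using F(2)[OF R(1)] R(2) by blast
    show ?thesis
    proof (rule hamiltonian_if_long_cycle_and_small_stable[OF _ _ vs(1)])
      show GR: "simple_graph n (H \<union> R)" using G R(1) by (simp add: simple_graph_def)
      show "d \<le> card (nbrs (H \<union> R) v)" if "v < n" for v
        using deg[OF that] card_mono[OF finite_nbrs[OF GR] nbrs_mono[of H "H \<union> R" v]] by simp
      \<comment> \<open>With \<open>n = 2 * d + k\<close> and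
        \<open>2 * d - 4 * k \<le> length vs\<close> it suffices that \<open>11 * k < d + 3\<close>;
        this is the source of the constant 11.\<close>
      show "3 * n < 2 * length vs + 3 * d + 3" using vs(2) d by linarith
      show "card S \<le> d" if "S \<subseteq> {..<n}" "stable (H \<union> R) S" for S
        using F12(3)[OF _ _ that] R(2) by blast
    qed
  qed
  moreover have "card {F, F\<^sub>1, F\<^sub>2} \<le> 3" by (simp add: card_insert_if)
  ultimately show ?thesis using F(1) F12(1,2) by (intro exI[of _ "{F, F\<^sub>1, F\<^sub>2}"]) auto
qed

section \<open>Random graphs\<close>

lemma random_graph_subset: "E \<in> set_pmf (random_graph n p) \<Longrightarrow> E \<subseteq> potential_edges n"
  by (auto simp: random_graph_def)

lemma finite_set_pmf_random_graph: "finite (set_pmf (random_graph n p))"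
  by (rule finite_subset[of _ "Pow (potential_edges n)"]) (auto dest: random_graph_subset)

lemma integrable_random_graph [simp]:
  fixes f :: "nat set set \<Rightarrow> real"
  shows "integrable (measure_pmf (random_graph n p)) f"
  by (intro integrable_measure_pmf_finite finite_set_pmf_random_graph)

section \<open>Moments and concentration of edge counts\<close>

lemma prob_random_graph_contains:
  assumes "T \<subseteq> potential_edges n" "0 \<le> p" "p \<le> 1"
  shows "measure_pmf.prob (random_graph n p) {E. T \<subseteq> E} = p ^ card T"
proof -
  let ?A = "potential_edges n"
  let ?B = "\<lambda>e. if e \<in> T then {True} else UNIV"
  have "(\<lambda>X. {e \<in> ?A. X e}) -` {E. T \<subseteq> E} = Pi ?A ?B"
    using assms(1) by (auto simp: Pi_def)
  then have "measure_pmf.prob (random_graph n p) {E. T \<subseteq> E} =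
      measure_pmf.prob (Pi_pmf ?A False (\<lambda>_. bernoulli_pmf p)) (Pi ?A ?B)"
    by (simp add: random_graph_def)
  also have "\<dots> = (\<Prod>e\<in>?A. measure_pmf.prob (bernoulli_pmf p) (?B e))"
    by (rule measure_Pi_pmf_Pi) simp
  also have "\<dots> = (\<Prod>e\<in>?A. if e \<in> T then p else 1)"
    using assms by (intro prod.cong) (auto simp: measure_pmf_single)
  also have "\<dots> = p ^ card T"
    using assms(1) by (simp add: prod.If_cases Int_absorb1)
  finally show ?thesis .
qed

text \<open>Stated for families of edge sets, so that it covers the first and second moments of edge
  counts as well as the mean number of incident pairs.\<close>

lemma expectation_count_contained:
  assumes I: "finite I" "\<And>i. i \<in> I \<Longrightarrow> T i \<subseteq> potential_edges n" and p: "0 \<le> p" "p \<le> 1"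
  shows "measure_pmf.expectation (random_graph n p) (\<lambda>E. real (card {i \<in> I. T i \<subseteq> E})) = (\<Sum>i\<in>I. p ^ card (T i))"
proof -
  have "real (card {i \<in> I. T i \<subseteq> E}) = (\<Sum>i\<in>I. indicator {E. T i \<subseteq> E} E)" for E
    using I(1) by (simp add: indicator_def sum.If_cases Int_def)
  then have "measure_pmf.expectation (random_graph n p) (\<lambda>E. real (card {i \<in> I. T i \<subseteq> E})) =
      (\<Sum>i\<in>I. measure_pmf.expectation (random_graph n p) (indicator {E. T i \<subseteq> E}))"
    by (simp add: Bochner_Integration.integral_sum)
  also have "\<dots> = (\<Sum>i\<in>I. p ^ card (T i))"
    using I(2) p by (intro sum.cong) (simp_all add: prob_random_graph_contains)
  finally show ?thesis .
qed

text \<open>Chebyshev's inequality, with the variance bounded by the mean.\<close>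

lemma prob_card_edges_deviation:
  assumes F: "F \<subseteq> potential_edges n" and p: "0 \<le> p" "p \<le> 1" and a: "0 < a"
  shows "measure_pmf.prob (random_graph n p) {E. a \<le> \<bar>real (card (E \<inter> F)) - p * card F\<bar>} \<le> p * card F / a\<^sup>2"
proof -
  let ?M = "random_graph n p"
  let ?X = "\<lambda>E. real (card (E \<inter> F))"
  have fin: "finite F" by (rule finite_subset[OF F]) simp
  have "{e \<in> F. {e} \<subseteq> E} = E \<inter> F" for E by auto
  then have EX: "measure_pmf.expectation ?M ?X = p * card F"
    using expectation_count_contained[OF fin _ p, of "\<lambda>e. {e}" n] F by (simp add: mult.commute subset_iff)
  \<comment> \<open>The square counts ordered pairs of present edges. On the diagonal
    \<open>{e, f}\<close> is a singleton, which contributes \<open>p\<close> instead of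
    \<open>p\<^sup>2\<close>.\<close>
  have "{i \<in> F \<times> F. {fst i, snd i} \<subseteq> E} = (E \<inter> F) \<times> (E \<inter> F)" for E by auto
  then have "real (card {i \<in> F \<times> F. {fst i, snd i} \<subseteq> E}) = (?X E)\<^sup>2" for E
    by (simp add: card_cartesian_product power2_eq_square)
  moreover have "{fst i, snd i} \<subseteq> potential_edges n" if "i \<in> F \<times> F" for i using that F by auto
  ultimately have "measure_pmf.expectation ?M (\<lambda>E. (?X E)\<^sup>2) = (\<Sum>i\<in>F \<times> F. p ^ card {fst i, snd i})"
    using expectation_count_contained[of "F \<times> F" "\<lambda>i. {fst i, snd i}" n p] fin p by simp
  also have "\<dots> = (\<Sum>e\<in>F. \<Sum>f\<in>F. p ^ card {e, f})"
    by (simp add: sum.cartesian_product case_prod_beta)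
  also have "\<dots> \<le> (\<Sum>e\<in>F. p + p\<^sup>2 * card F)"
  proof (rule sum_mono)
    fix e assume e: "e \<in> F"
    have "(\<Sum>f\<in>F. p ^ card {e, f}) = p + (\<Sum>f\<in>F - {e}. p ^ card {e, f})"
      using sum.remove[OF fin e, of "\<lambda>f. p ^ card {e, f}"] by simp
    also have "(\<Sum>f\<in>F - {e}. p ^ card {e, f}) = (\<Sum>f\<in>F - {e}. p\<^sup>2)"
      by (intro sum.cong) (auto simp: card_insert_if power2_eq_square)
    also have "\<dots> \<le> p\<^sup>2 * card F"
      using fin e by (auto simp: mult.commute[of "p\<^sup>2"] intro!: mult_right_mono)
    finally show "(\<Sum>f\<in>F. p ^ card {e, f}) \<le> p + p\<^sup>2 * card F" by simp
  qed
  also have "\<dots> = p * card F + (p * card F)\<^sup>2" by (simp add: algebra_simps power2_eq_square)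
  finally have "measure_pmf.variance ?M ?X \<le> p * card F"
    using EX by (subst measure_pmf.variance_eq) simp_all
  then have "measure_pmf.variance ?M ?X / a\<^sup>2 \<le> p * card F / a\<^sup>2"
    by (simp add: divide_right_mono)
  moreover have "measure_pmf.prob ?M {E \<in> space ?M. a \<le> \<bar>?X E - measure_pmf.expectation ?M ?X\<bar>}
      \<le> measure_pmf.variance ?M ?X / a\<^sup>2"
    by (rule measure_pmf.Chebyshev_inequality) (simp_all add: a)
  ultimately show ?thesis using EX by simp
qed

section \<open>Incident edges and matchings\<close>

definition incident_pairs :: "nat set set \<Rightarrow> (nat set \<times> nat set) set" where
  "incident_pairs E = {(e, f). e \<in> E \<and> f \<in> E \<and> e \<noteq> f \<and> e \<inter> f \<noteq> {}}"

lemma finite_incident_pairs: "finite E \<Longrightarrow> finite (incident_pairs E)"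
  by (rule finite_subset[of _ "E \<times> E"]) (auto simp: incident_pairs_def)

text \<open>A pair is determined by a common vertex and the other end of each edge.\<close>

lemma card_incident_pairs_le:
  assumes "F \<subseteq> potential_edges n"
  shows "card (incident_pairs F) \<le> n ^ 3"
proof -
  let ?V = "{..<n}"
  have "incident_pairs F \<subseteq> (\<lambda>(x, y, z). ({x, y}, {x, z})) ` (?V \<times> ?V \<times> ?V)"
  proof
    fix i assume "i \<in> incident_pairs F"
    then obtain e f x where i: "i = (e, f)" "e \<in> F" "f \<in> F" "x \<in> e" "x \<in> f"
      by (auto simp: incident_pairs_def)
    have "\<exists>y<n. x < n \<and> g = {x, y}" if g: "g \<in> F" "x \<in> g" for g
    proof -
      obtain u v where "u \<in> ?V" "v \<in> ?V" "g = {u, v}"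
        using g(1) assms unfolding potential_edges_def by (meson nsets2_E subsetD)
      then show ?thesis using g(2) by auto
    qed
    then obtain y z where "y < n" "z < n" "x < n" "e = {x, y}" "f = {x, z}"
      using i by metis
    then show "i \<in> (\<lambda>(x, y, z). ({x, y}, {x, z})) ` (?V \<times> ?V \<times> ?V)"
      using i(1) by (intro image_eqI[of _ _ "(x, y, z)"]) auto
  qed
  then have "card (incident_pairs F) \<le> card (?V \<times> ?V \<times> ?V)"
    by (intro surj_card_le) auto
  then show ?thesis by (simp add: card_cartesian_product power3_eq_cube)
qed

text \<open>Deleting every edge that meets another leaves a matching. Each deleted edge is the first
  component of an incident pair, so there are at most as many deletions as pairs.\<close>

lemma has_matching_if_few_incident_pairs:
  assumes "finite E" "k + card (incident_pairs E) \<le> card E"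
  shows "has_matching k E"
proof -
  let ?M = "E - fst ` incident_pairs E"
  have "card (fst ` incident_pairs E) \<le> card (incident_pairs E)"
    by (intro card_image_le finite_incident_pairs assms)
  moreover have "card E - card (fst ` incident_pairs E) \<le> card ?M"
    using finite_incident_pairs[OF assms(1)] by (intro diff_card_le_card_Diff) simp
  moreover have "pairwise disjnt ?M"
  proof (rule pairwiseI, rule ccontr)
    fix e f assume ef: "e \<in> ?M" "f \<in> ?M" "e \<noteq> f" "\<not> disjnt e f"
    then have "(e, f) \<in> incident_pairs E" by (auto simp: incident_pairs_def disjnt_def)
    then show False using ef(1) image_eqI[of e fst "(e, f)"] by simp
  qed
  ultimately show ?thesis
    unfolding has_matching_def using assms by (intro exI[of _ ?M]) auto
qed

lemma prob_many_incident_pairs: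
  assumes F: "F \<subseteq> potential_edges n" and p: "0 \<le> p" "p \<le> 1" and b: "0 < b"
  shows "measure_pmf.prob (random_graph n p) {E. b \<le> real (card (incident_pairs (E \<inter> F)))} \<le> p\<^sup>2 * real n ^ 3 / b"
proof -
  let ?M = "random_graph n p"
  let ?Z = "\<lambda>E. real (card (incident_pairs (E \<inter> F)))"
  have fin: "finite F" by (rule finite_subset[OF F]) simp
  have "{i \<in> incident_pairs F. {fst i, snd i} \<subseteq> E} = incident_pairs (E \<inter> F)" for E
    by (auto simp: incident_pairs_def)
  moreover have "{fst i, snd i} \<subseteq> potential_edges n" if "i \<in> incident_pairs F" for i
    using that F by (auto simp: incident_pairs_def)
  ultimately have "measure_pmf.expectation ?M ?Z = (\<Sum>i\<in>incident_pairs F. p ^ card {fst i, snd i})"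
    using expectation_count_contained[OF finite_incident_pairs[OF fin] _ p, of "\<lambda>i. {fst i, snd i}" n]
    by simp
  also have "\<dots> = (\<Sum>i\<in>incident_pairs F. p\<^sup>2)"
    by (intro sum.cong) (auto simp: incident_pairs_def card_insert_if power2_eq_square)
  also have "\<dots> = p\<^sup>2 * real (card (incident_pairs F))" by simp
  also have "\<dots> \<le> p\<^sup>2 * real n ^ 3"
    using card_incident_pairs_le[OF F] by (intro mult_left_mono) (simp_all flip: of_nat_power)
  finally have EZ: "measure_pmf.expectation ?M ?Z \<le> p\<^sup>2 * real n ^ 3" .
  have "measure_pmf.prob ?M {E \<in> space ?M. b \<le> ?Z E} \<le> measure_pmf.expectation ?M ?Z / b"
    by (rule integral_Markov_inequality_measure[where A = "{}"]) (simp_all add: b)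
  also have "\<dots> \<le> p\<^sup>2 * real n ^ 3 / b" using EZ b by (simp add: divide_right_mono)
  finally show ?thesis by simp
qed

text \<open>Outside two bad events, \<open>F\<close> receives more than \<open>k + b\<close> random
  edges and fewer than \<open>b\<close> incident pairs among them, so a matching of size
  \<open>k\<close> survives the deletion.\<close>

lemma prob_no_matching:
  assumes F: "many_edges n d F" and p: "0 \<le> p" "p \<le> 1" and ab: "0 < a" "0 < b"
    and k: "real k + a + b \<le> p * (real d)\<^sup>2 / 2"
  shows "measure_pmf.prob (random_graph n p) {E. \<not> has_matching k (E \<inter> F)}
    \<le> p * (real n)\<^sup>2 / (2 * a\<^sup>2) + p\<^sup>2 * real n ^ 3 / b"
proof -
  let ?M = "random_graph n p"
  have F': "F \<subseteq> potential_edges n" "d * (d + 1) \<le> 2 * card F" using F by (auto simp: many_edges_def)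
  have fin: "finite F" by (rule finite_subset[OF F'(1)]) simp
  have "2 * card F \<le> 2 * card (potential_edges n)" using F' by (simp add: card_mono)
  also have "\<dots> \<le> n * n" unfolding potential_edges_def two_card_nsets_2 by simp
  finally have "real (2 * card F) \<le> real (n * n)" by (simp only: of_nat_le_iff)
  then have up: "real (card F) \<le> (real n)\<^sup>2 / 2" by (simp add: power2_eq_square)
  have "d * d \<le> 2 * card F" using F'(2) by simp
  then have "real (d * d) \<le> real (2 * card F)" by (simp only: of_nat_le_iff)
  then have "(real d)\<^sup>2 / 2 \<le> real (card F)" by (simp add: power2_eq_square)
  from mult_left_mono[OF this p(1)] have lo: "real k + a + b \<le> p * real (card F)" using k by simp
  have "{E. \<not> has_matching k (E \<inter> F)} \<subseteq>
     {E. a \<le> \<bar>real (card (E \<inter> F)) - p * card F\<bar>} \<union> {E. b \<le> real (card (incident_pairs (E \<inter> F)))}"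
  proof (rule subsetI, rule ccontr)
    fix E assume E: "E \<in> {E. \<not> has_matching k (E \<inter> F)}"
      and "E \<notin> {E. a \<le> \<bar>real (card (E \<inter> F)) - p * card F\<bar>} \<union> {E. b \<le> real (card (incident_pairs (E \<inter> F)))}"
    then have "real k + real (card (incident_pairs (E \<inter> F))) \<le> real (card (E \<inter> F))"
      using lo by (simp add: abs_less_iff not_le)
    then have "k + card (incident_pairs (E \<inter> F)) \<le> card (E \<inter> F)" by linarith
    then show False using has_matching_if_few_incident_pairs[of "E \<inter> F"] E fin by simp
  qed
  then have "measure_pmf.prob ?M {E. \<not> has_matching k (E \<inter> F)} \<le>
      measure_pmf.prob ?M ({E. a \<le> \<bar>real (card (E \<inter> F)) - p * card F\<bar>} \<union> {E. b \<le> real (card (incident_pairs (E \<inter> F)))})"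
    by (intro measure_pmf.finite_measure_mono) auto
  also have "\<dots> \<le> measure_pmf.prob ?M {E. a \<le> \<bar>real (card (E \<inter> F)) - p * card F\<bar>} +
      measure_pmf.prob ?M {E. b \<le> real (card (incident_pairs (E \<inter> F)))}"
    by (intro measure_Un_le) auto
  also have "\<dots> \<le> p * card F / a\<^sup>2 + p\<^sup>2 * real n ^ 3 / b"
    by (intro add_mono prob_card_edges_deviation[OF F'(1) p ab(1)] prob_many_incident_pairs[OF F'(1) p ab(2)])
  also have "p * card F / a\<^sup>2 \<le> p * ((real n)\<^sup>2 / 2) / a\<^sup>2"
    using up p by (intro divide_right_mono mult_left_mono) auto
  finally show ?thesis by simp
qed

section \<open>Coupling of random graphs\<close>

lemma bernoulli_pmf_disj:
  assumes "0 \<le> p" "p \<le> 1" "0 \<le> r" "r \<le> 1"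
  shows "map_pmf (\<lambda>(x, z). x \<or> z) (pair_pmf (bernoulli_pmf p) (bernoulli_pmf r)) =
    bernoulli_pmf (1 - (1 - p) * (1 - r))"
    (is "?L = ?R")
proof -
  have q: "0 \<le> 1 - (1 - p) * (1 - r)" "1 - (1 - p) * (1 - r) \<le> 1"
    using assms by (auto simp: mult_le_one)
  have "(\<lambda>(x, z). x \<or> z) -` {False} = {(False, False)}" by auto
  then have "pmf ?L False = pmf (pair_pmf (bernoulli_pmf p) (bernoulli_pmf r)) (False, False)"
    by (simp add: pmf_map measure_pmf_single)
  then have "pmf ?L False = pmf ?R False"
    using assms q by (simp add: pmf_pair)
  moreover have "pmf ?L True = pmf ?R True"
    using \<open>pmf ?L False = pmf ?R False\<close> by (simp only: pmf_False_conv_True)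
  ultimately show ?thesis by (intro pmf_eqI) (metis (full_types))
qed

text \<open>Sprinkling: with \<open>1 - q = (1 - p) * (1 - r)\<close>, the graph with parameter
  \<open>q\<close> is the union of independent graphs with parameters \<open>p\<close> and
  \<open>r\<close>.\<close>

lemma prob_random_graph_mono:
  assumes p: "0 \<le> p" "p \<le> q" "q \<le> 1"
    and Q: "\<And>E E'. E \<subseteq> E' \<Longrightarrow> Q E \<Longrightarrow> Q E'"
  shows "measure_pmf.prob (random_graph n p) {E. Q E} \<le> measure_pmf.prob (random_graph n q) {E. Q E}"
proof (cases "p = 1")
  case True
  then show ?thesis using p by simp
next
  case False
  then have p1: "p < 1" using p by simp
  define r where "r = (q - p) / (1 - p)"
  have r: "0 \<le> r" "r \<le> 1" "1 - (1 - p) * (1 - r) = q"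
    using p p1 by (auto simp: r_def field_simps)
  let ?A = "potential_edges n"
  define M where "M = Pi_pmf ?A (False, False) (\<lambda>_. pair_pmf (bernoulli_pmf p) (bernoulli_pmf r))"
  have "Pi_pmf ?A False (\<lambda>_. bernoulli_pmf p) = map_pmf (\<lambda>g. fst \<circ> g) M"
    unfolding M_def by (subst Pi_pmf_map[symmetric]) (simp_all add: map_fst_pair_pmf)
  then have 1: "random_graph n p = map_pmf (\<lambda>g. {e \<in> ?A. fst (g e)}) M"
    by (simp add: random_graph_def pmf.map_comp o_def)
  have "Pi_pmf ?A False (\<lambda>_. bernoulli_pmf q) = map_pmf (\<lambda>g. (\<lambda>(x, z). x \<or> z) \<circ> g) M"
    unfolding M_def using bernoulli_pmf_disj[OF p(1) _ r(1,2)] p1 r(3)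
    by (subst Pi_pmf_map[symmetric]) simp_all
  then have 2: "random_graph n q = map_pmf (\<lambda>g. {e \<in> ?A. fst (g e) \<or> snd (g e)}) M"
    by (simp add: random_graph_def pmf.map_comp o_def case_prod_beta)
  show ?thesis
    unfolding 1 2 measure_map_pmf
    by (intro measure_pmf.finite_measure_mono) (auto elim!: Q[rotated])
qed

lemma hamiltonian_mono: "E \<subseteq> E' \<Longrightarrow> hamiltonian n E \<Longrightarrow> hamiltonian n E'"
  unfolding hamiltonian_def is_cycle_def by blast

text \<open>The union bound over at most three edge sets is taken at \<open>q\<close> and carried
  over to \<open>p\<close> by monotonicity, since the bound on incident pairs deteriorates as the
  edge probability grows.\<close>

lemma prob_hamiltonian_ge:
  assumes H: "simple_graph n H" and deg: "\<And>v. v < n \<Longrightarrow> d \<le> card (nbrs H v)"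
    and d: "2 * d + k = n" "2 \<le> k" "11 * k \<le> d"
    and pq: "0 \<le> q" "q \<le> p" "p \<le> 1" and ab: "0 < a" "0 < b"
    and k: "real k + a + b \<le> q * (real d)\<^sup>2 / 2"
  shows "1 - 3 * (q * (real n)\<^sup>2 / (2 * a\<^sup>2) + q\<^sup>2 * real n ^ 3 / b)
    \<le> measure_pmf.prob (random_graph n p) {E. hamiltonian n (H \<union> E)}"
proof -
  let ?M = "random_graph n q"
  define \<beta> where "\<beta> = q * (real n)\<^sup>2 / (2 * a\<^sup>2) + q\<^sup>2 * real n ^ 3 / b"
  have \<beta>: "0 \<le> \<beta>" using pq ab by (simp add: \<beta>_def)
  obtain \<F> where \<F>: "finite \<F>" "card \<F> \<le> 3" "\<And>F. F \<in> \<F> \<Longrightarrow> many_edges n d F"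
    "\<And>R. simple_graph n R \<Longrightarrow> (\<And>F. F \<in> \<F> \<Longrightarrow> has_matching k (R \<inter> F)) \<Longrightarrow> hamiltonian n (H \<union> R)"
    using hamiltonian_if_matchings[OF H deg d] by blast
  have "measure_pmf.prob ?M {E. \<not> hamiltonian n (H \<union> E)} \<le>
      measure_pmf.prob ?M (\<Union>F\<in>\<F>. {E. \<not> has_matching k (E \<inter> F)})"
  \<comment> \<open>The criterion speaks of simple graphs, so the inclusion of events is shown on
    the support.\<close>
  proof (rule measure_pmf.finite_measure_mono_AE)
    show "AE E in ?M. E \<in> {E. \<not> hamiltonian n (H \<union> E)} \<longrightarrow> E \<in> (\<Union>F\<in>\<F>. {E. \<not> has_matching k (E \<inter> F)})"
    proof (intro AE_pmfI impI)
      fix E assume E: "E \<in> set_pmf ?M" "E \<in> {E. \<not> hamiltonian n (H \<union> E)}"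
      have "simple_graph n E" using random_graph_subset[OF E(1)] by (simp add: simple_graph_def)
      then show "E \<in> (\<Union>F\<in>\<F>. {E. \<not> has_matching k (E \<inter> F)})" using \<F>(4)[of E] E(2) by blast
    qed
  qed simp
  also have "\<dots> \<le> (\<Sum>F\<in>\<F>. measure_pmf.prob ?M {E. \<not> has_matching k (E \<inter> F)})"
    using \<F>(1) by (intro measure_pmf.finite_measure_subadditive_finite) auto
  also have "\<dots> \<le> (\<Sum>F\<in>\<F>. \<beta>)"
    unfolding \<beta>_def using prob_no_matching[OF \<F>(3) pq(1) _ ab k] pq by (intro sum_mono) auto
  also have "\<dots> = real (card \<F>) * \<beta>" by simp
  also have "\<dots> \<le> 3 * \<beta>" using \<F>(2) \<beta> by (intro mult_right_mono) auto
  finally have "measure_pmf.prob ?M {E. \<not> hamiltonian n (H \<union> E)} \<le> 3 * \<beta>" .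
  moreover have "measure_pmf.prob ?M {E. \<not> hamiltonian n (H \<union> E)} =
      1 - measure_pmf.prob ?M {E. hamiltonian n (H \<union> E)}"
    using measure_pmf.prob_compl[of "{E. hamiltonian n (H \<union> E)}" ?M]
    by (simp add: Compl_eq_Diff_UNIV[symmetric] Collect_neg_eq)
  moreover have "measure_pmf.prob ?M {E. hamiltonian n (H \<union> E)} \<le>
      measure_pmf.prob (random_graph n p) {E. hamiltonian n (H \<union> E)}"
    using pq by (intro prob_random_graph_mono) (auto elim!: hamiltonian_mono[rotated])
  ultimately show ?thesis unfolding \<beta>_def by linarith
qed

text \<open>At most \<open>D\<close> of the \<open>n - D\<close> vertices in \<open>{D..<n}\<close>
  have their cycle successor in the other part. So at least \<open>n - 2 * D\<close> cycle edges
  stay inside \<open>{D..<n}\<close>, where the bipartite graph has none.\<close>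

lemma complete_bipartite_hamiltonian:
  assumes "D \<le> n" and ham: "hamiltonian n (edges_between {..<D} {D..<n} \<union> E)"
  shows "n \<le> 2 * D + card (E \<inter> nsets {D..<n} 2)"
proof -
  let ?B = "{D..<n}"
  obtain vs where vs: "is_cycle (edges_between {..<D} ?B \<union> E) vs" "set vs = {..<n}"
    using ham by (auto simp: hamiltonian_def)
  have dist: "distinct vs" and len: "length vs = n" and n3: "3 \<le> n"
    using vs distinct_card[of vs] by (auto simp: is_cycle_def)
  define s where "s i = Suc i mod n" for i
  have s: "s i < n" for i using n3 by (simp add: s_def)
  have inj: "inj_on s {..<n}" using inj_on_Suc_mod unfolding s_def .
  \<comment> \<open>Since the cycle has at least three vertices, no edge arises from two positions
    in opposite directions.\<close>
  have ss: "s i \<noteq> i" "s (s i) \<noteq> i" if "i < n" for i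
    using that n3 by (auto simp: s_def mod_Suc)
  have eq: "vs ! i = vs ! j \<longleftrightarrow> i = j" if "i < n" "j < n" for i j
    using that dist len by (simp add: nth_eq_iff_index_eq)
  define I where "I = {i. i < n \<and> vs ! i \<in> ?B \<and> vs ! s i \<in> ?B}"
  define J where "J = {i. i < n \<and> vs ! i \<in> ?B}"
  define K where "K = {i. i < n \<and> vs ! s i \<in> {..<D}}"
  have cJ: "card J = n - D"
    using card_index_set[OF dist, of ?B] vs(2) len by (simp add: J_def Int_absorb2 subset_iff)
  have "s ` K \<subseteq> {j. j < n \<and> vs ! j \<in> {..<D}}" using s by (auto simp: K_def)
  then have "card (s ` K) \<le> card {j. j < n \<and> vs ! j \<in> {..<D}}" by (intro card_mono) auto
  also have "\<dots> = D"
    using card_index_set[OF dist, of "{..<D}"] vs(2) len assms(1) by (simp add: Int_absorb2)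
  also have "card (s ` K) = card K"
    by (intro card_image inj_on_subset[OF inj]) (auto simp: K_def)
  finally have cK: "card K \<le> D" .
  have "vs ! i < n" if "i < n" for i using that vs(2) len nth_mem by blast
  then have "J \<subseteq> I \<union> K" using s by (auto simp: I_def J_def K_def)
  then have "card J \<le> card (I \<union> K)" by (intro card_mono) (auto simp: I_def K_def)
  then have JI: "n - D \<le> card I + D" using cJ cK card_Un_le[of I K] by linarith
  let ?g = "\<lambda>i. {vs ! i, vs ! s i}"
  have "inj_on ?g I"
  proof (rule inj_onI)
    fix i j assume ij: "i \<in> I" "j \<in> I" "?g i = ?g j"
    then have l: "i < n" "j < n" by (auto simp: I_def)
    from ij(3) have "vs ! i = vs ! j \<or> vs ! i = vs ! s j \<and> vs ! s i = vs ! j"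
      by (auto simp: doubleton_eq_iff)
    then show "i = j" using eq l s ss(2)[OF l(1)] by metis
  qed
  moreover have "?g ` I \<subseteq> E \<inter> nsets ?B 2"
  proof
    fix e assume "e \<in> ?g ` I"
    then obtain i where i: "i \<in> I" "e = ?g i" by auto
    then have l: "i < n" "vs ! i \<in> ?B" "vs ! s i \<in> ?B" by (auto simp: I_def)
    have "e \<in> edges_between {..<D} ?B \<union> E"
      using vs(1) l(1) len i(2) by (simp add: is_cycle_def s_def)
    moreover have "e \<notin> edges_between {..<D} ?B"
      using l i(2) by (auto simp: edges_between_def doubleton_eq_iff)
    moreover have "vs ! i \<noteq> vs ! s i" using eq[OF l(1) s] ss(1)[OF l(1)] by auto
    ultimately show "e \<in> E \<inter> nsets ?B 2" using l i(2) by simp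
  qed
  moreover have "finite (E \<inter> nsets ?B 2)" by (simp add: finite_imp_finite_nsets)
  ultimately have "card I \<le> card (E \<inter> nsets ?B 2)" by (metis card_image card_mono)
  then show ?thesis using JI by linarith
qed

lemma card_nbrs_complete_bipartite:
  assumes "v < n" "2 * D \<le> n"
  shows "D \<le> card (nbrs (edges_between {..<D} {D..<n}) v)"
proof -
  have "nbrs (edges_between {..<D} {D..<n}) v = (if v < D then {D..<n} else {..<D})"
    using assms by (auto simp: adj_def edges_between_def doubleton_eq_iff image_iff)
  then show ?thesis using assms by auto
qed

text \<open>A Hamilton cycle forces the number of random edges inside \<open>{D..<n}\<close> to
  exceed its mean by at least \<open>a\<close>.\<close>

lemma prob_bipartite_hamiltonian_le:
  assumes D: "D \<le> n" and p: "0 \<le> p" "p \<le> 1" and a: "0 < a"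
    and m: "p * (real n - real D)\<^sup>2 / 2 + a \<le> real n - 2 * real D"
  shows "measure_pmf.prob (random_graph n p) {E. hamiltonian n (edges_between {..<D} {D..<n} \<union> E)}
    \<le> (real n - 2 * real D) / a\<^sup>2"
proof -
  let ?F = "nsets {D..<n} 2"
  have F: "?F \<subseteq> potential_edges n" unfolding potential_edges_def by (intro nsets_mono) auto
  have "2 * card ?F \<le> (n - D) * (n - D)"
    unfolding two_card_nsets_2 by (intro mult_mono) auto
  then have "real (2 * card ?F) \<le> real ((n - D) * (n - D))" by (simp only: of_nat_le_iff)
  then have "real (card ?F) \<le> (real n - real D)\<^sup>2 / 2" using D by (simp add: power2_eq_square)
  from mult_left_mono[OF this p(1)] have up: "p * real (card ?F) + a \<le> real n - 2 * real D"
    using m by (simp del: card_nsets)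
  have "a \<le> \<bar>real (card (E \<inter> ?F)) - p * card ?F\<bar>"
    if "hamiltonian n (edges_between {..<D} {D..<n} \<union> E)" for E
    using complete_bipartite_hamiltonian[OF D that] up by linarith
  then have "measure_pmf.prob (random_graph n p) {E. hamiltonian n (edges_between {..<D} {D..<n} \<union> E)} \<le>
      measure_pmf.prob (random_graph n p) {E. a \<le> \<bar>real (card (E \<inter> ?F)) - p * card ?F\<bar>}"
    by (intro measure_pmf.finite_measure_mono) auto
  also have "\<dots> \<le> p * card ?F / a\<^sup>2" by (rule prob_card_edges_deviation[OF F p a])
  also have "\<dots> \<le> (real n - 2 * real D) / a\<^sup>2"
    using up a by (intro divide_right_mono) auto
  finally show ?thesis .
qed

section \<open>The sharp threshold\<close>

lemma min_degree_ge:
  assumes "simple_graph n E" "0 < n" "\<And>v. v < n \<Longrightarrow> D \<le> card (nbrs E v)"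
  shows "D \<le> min_degree n E"
  unfolding min_degree_def using assms by (subst Min_ge_iff) (auto simp: degree_eq_card_nbrs)

text \<open>The complete graph stands in when \<open>2 * d\<close> exceeds \<open>n\<close>, so that
  the degree condition holds whenever \<open>d < n\<close>. For negative \<open>d\<close>,
  \<open>nat d = 0\<close> makes the graph empty.\<close>

definition extremal_graph :: "nat \<Rightarrow> int \<Rightarrow> nat set set" where
  "extremal_graph n d = (if 2 * d \<le> int n then edges_between {..<nat d} {nat d..<n} else potential_edges n)"

lemma simple_graph_extremal: "simple_graph n (extremal_graph n d)"
  by (auto simp: extremal_graph_def simple_graph_def edges_between_def potential_edges_iff)

lemma min_degree_extremal:
  assumes "0 < n" "d < int n"
  shows "d \<le> int (min_degree n (extremal_graph n d))"
proof (cases "2 * d \<le> int n")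
  case True
  have "nat d \<le> min_degree n (extremal_graph n d)"
  proof (rule min_degree_ge[OF simple_graph_extremal assms(1)])
    fix v assume "v < n"
    then have "nat d \<le> card (nbrs (edges_between {..<nat d} {nat d..<n}) v)"
      using True assms by (intro card_nbrs_complete_bipartite) auto
    then show "nat d \<le> card (nbrs (extremal_graph n d) v)" using True by (simp add: extremal_graph_def)
  qed
  then show ?thesis by linarith
next
  case False
  have "n - 1 \<le> min_degree n (extremal_graph n d)"
  proof (rule min_degree_ge[OF simple_graph_extremal assms(1)])
    fix v assume v: "v < n"
    have "nbrs (potential_edges n) v = {..<n} - {v}"
      using v unfolding nbrs_def adj_def potential_edges_iff by auto
    then show "n - 1 \<le> card (nbrs (extremal_graph n d) v)" using v False by (simp add: extremal_graph_def)
  qed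
  then show ?thesis using assms by linarith
qed

text \<open>The larger part has \<open>n / 2 + \<eta>\<close> vertices, so its expected number of
  random edges is at most about \<open>2 * \<eta> * (1 - \<epsilon>)\<close>; with the correction
  for its size this still falls short of the required \<open>2 * \<eta>\<close> by
  \<open>\<epsilon> * \<eta>\<close>.\<close>

lemma prob_extremal_hamiltonian_le:
  fixes \<eta> \<epsilon> p :: real and n D :: nat
  assumes D: "real D = real n / 2 - \<eta>" and n: "0 < n" and \<eta>: "0 < \<eta>" and \<epsilon>: "0 < \<epsilon>" "\<epsilon> \<le> 1 / 2"
    and x: "\<eta> \<le> \<epsilon> / 16 * real n" and p: "0 \<le> p" "p \<le> 1" "p \<le> (1 - \<epsilon>) * (16 * \<eta> / (real n)\<^sup>2)"
  shows "measure_pmf.prob (random_graph n p) {E. hamiltonian n (edges_between {..<D} {D..<n} \<union> E)}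
    \<le> 2 / \<epsilon>\<^sup>2 * inverse \<eta>"
proof -
  define y where "y = \<eta> / real n"
  have y: "0 < y" "y \<le> \<epsilon> / 16" "\<eta> = y * real n" using n \<eta> x by (auto simp: y_def field_simps)
  have "real D \<le> real n" using D \<eta> by simp
  then have Dn: "D \<le> n" by simp
  have nD: "real n - real D = real n / 2 * (1 + 2 * y)" using D y by (simp add: algebra_simps)
  have "p * (real n - real D)\<^sup>2 / 2 \<le> (1 - \<epsilon>) * (16 * \<eta> / (real n)\<^sup>2) * (real n - real D)\<^sup>2 / 2"
    using p by (intro divide_right_mono mult_right_mono) auto
  also have "\<dots> = 2 * \<eta> * ((1 - \<epsilon>) * (1 + 2 * y)\<^sup>2)"
    unfolding nD using n by (simp add: power2_eq_square field_simps)
  finally have mean: "p * (real n - real D)\<^sup>2 / 2 \<le> 2 * \<eta> * ((1 - \<epsilon>) * (1 + 2 * y)\<^sup>2)" .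
  have "(1 - \<epsilon>) * (1 + 2 * y)\<^sup>2 \<le> 1 - \<epsilon> / 2"
  proof -
    have "y * y \<le> y * 1" using y \<epsilon> by (intro mult_left_mono) auto
    then have "(1 + 2 * y)\<^sup>2 \<le> 1 + 8 * y" by (simp add: power2_eq_square algebra_simps)
    then have "(1 - \<epsilon>) * (1 + 2 * y)\<^sup>2 \<le> (1 - \<epsilon>) * (1 + 8 * y)" using \<epsilon> by (intro mult_left_mono) auto
    also have "\<dots> \<le> 1 - \<epsilon> + 8 * y" using y \<epsilon> by (simp add: algebra_simps)
    \<comment> \<open>The bound \<open>y \<le> \<epsilon> / 16\<close> makes \<open>8 * y\<close>
      cost at most half of \<open>\<epsilon>\<close>.\<close>
    finally show ?thesis using y by simp
  qed
  then have "2 * \<eta> * ((1 - \<epsilon>) * (1 + 2 * y)\<^sup>2) \<le> 2 * \<eta> * (1 - \<epsilon> / 2)" using \<eta> by (intro mult_left_mono) auto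
  also have "2 * \<eta> * (1 - \<epsilon> / 2) = real n - 2 * real D - \<epsilon> * \<eta>"
    using D by (simp add: algebra_simps)
  finally have "p * (real n - real D)\<^sup>2 / 2 + \<epsilon> * \<eta> \<le> real n - 2 * real D" using mean by linarith
  then have "measure_pmf.prob (random_graph n p) {E. hamiltonian n (edges_between {..<D} {D..<n} \<union> E)}
      \<le> (real n - 2 * real D) / (\<epsilon> * \<eta>)\<^sup>2"
    using \<epsilon> \<eta> by (intro prob_bipartite_hamiltonian_le[OF Dn p(1,2)]) auto
  also have "real n - 2 * real D = 2 * \<eta>" using D by simp
  also have "2 * \<eta> / (\<epsilon> * \<eta>)\<^sup>2 = 2 / \<epsilon>\<^sup>2 * inverse \<eta>"
    using \<epsilon>(1) \<eta> by (simp add: power2_eq_square divide_simps)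
  finally show ?thesis .
qed

text \<open>For fixed \<open>\<epsilon>\<close>, the error from the edge counts is of order
  \<open>1 / \<eta>\<close> and that from incident pairs of order \<open>\<eta> / n\<close>. These
  two terms are why \<open>\<eta>\<close> must tend to infinity and be of smaller order than
  \<open>n\<close>.\<close>

lemma prob_perturbed_hamiltonian_ge:
  fixes \<eta> \<epsilon> p :: real and n D :: nat
  assumes H: "simple_graph n H" "\<And>v. v < n \<Longrightarrow> D \<le> card (nbrs H v)"
    and D: "real D = real n / 2 - \<eta>" and n: "0 < n" and \<eta>: "1 \<le> \<eta>" and \<epsilon>: "0 < \<epsilon>" "\<epsilon> \<le> 1"
    and x: "\<eta> \<le> \<epsilon> / 50 * real n" and p: "p \<le> 1" "(1 + \<epsilon>) * (16 * \<eta> / (real n)\<^sup>2) \<le> p"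
  shows "1 - 3 * (256 / \<epsilon>\<^sup>2 * inverse \<eta> + 4096 / \<epsilon> * (\<eta> / real n))
    \<le> measure_pmf.prob (random_graph n p) {E. hamiltonian n (H \<union> E)}"
proof -
  define y where "y = \<eta> / real n"
  define q where "q = (1 + \<epsilon>) * (16 * \<eta> / (real n)\<^sup>2)"
  \<comment> \<open>The mean exceeds \<open>k = 2 * \<eta>\<close> by about
    \<open>2 * \<epsilon> * \<eta>\<close>. Of this, \<open>a\<close> goes to the deviation and
    another \<open>a\<close> to incident pairs; the rest absorbs the loss from
    \<open>D < n / 2\<close>.\<close>
  define a where "a = \<epsilon> * \<eta> / 4"
  have y: "0 < y" "y \<le> \<epsilon> / 50" "\<eta> = y * real n" using n \<eta> x by (auto simp: y_def field_simps)
  have x1: "\<eta> \<le> real n / 50"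
  proof -
    have "\<epsilon> / 50 * real n \<le> 1 / 50 * real n" using \<epsilon> by (intro mult_right_mono) auto
    then show ?thesis using x by simp
  qed
  define k where "k = n - 2 * D"
  have "real (2 * D) \<le> real n" using D \<eta> by simp
  then have Dn: "2 * D \<le> n" by (simp only: of_nat_le_iff)
  then have k: "2 * D + k = n" by (simp add: k_def)
  have rk: "real k = 2 * \<eta>" using Dn D by (simp add: k_def)
  have "real 2 \<le> real k" using rk \<eta> by simp
  then have k2: "2 \<le> k" by (simp only: of_nat_le_iff)
  \<comment> \<open>This amounts to \<open>22 * \<eta> \<le> n / 2 - \<eta>\<close>, that is
    \<open>\<eta> \<le> n / 46\<close>, which the constant 50 guarantees.\<close>
  have "real (11 * k) \<le> real D" using rk D x1 by simp
  then have k11: "11 * k \<le> D" by (simp only: of_nat_le_iff)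
  have nz: "real n \<noteq> 0" "\<epsilon> \<noteq> 0" "\<eta> \<noteq> 0" using n \<epsilon> \<eta> by auto
  have q0: "0 \<le> q" using \<epsilon> \<eta> by (simp add: q_def)
  have a0: "0 < a" using \<epsilon> \<eta> by (simp add: a_def)
  have rD: "real D = real n / 2 * (1 - 2 * y)" using D y by (simp add: algebra_simps)
  have "2 * \<eta> + a + a = 2 * \<eta> * (1 + \<epsilon> / 4)" by (simp add: a_def algebra_simps)
  also have "\<dots> \<le> 2 * \<eta> * ((1 + \<epsilon>) * (1 - 4 * y))"
  proof (rule mult_left_mono)
    have "(1 + \<epsilon>) * (4 * y) \<le> 2 * (4 * y)" using \<epsilon> y by (intro mult_right_mono) auto
    moreover have "(1 + \<epsilon>) * (1 - 4 * y) = 1 + \<epsilon> - (1 + \<epsilon>) * (4 * y)" by (simp add: algebra_simps)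
    ultimately show "1 + \<epsilon> / 4 \<le> (1 + \<epsilon>) * (1 - 4 * y)" using y(2) \<epsilon> by linarith
  qed (use \<eta> in simp)
  also have "\<dots> \<le> 2 * \<eta> * ((1 + \<epsilon>) * (1 - 2 * y)\<^sup>2)"
    using \<epsilon> \<eta> y by (intro mult_left_mono) (auto simp: power2_eq_square algebra_simps)
  also have "\<dots> = q * (real D)\<^sup>2 / 2"
    unfolding rD q_def using n by (simp add: power2_eq_square field_simps)
  finally have kk: "real k + a + a \<le> q * (real D)\<^sup>2 / 2" using rk by simp
  have main: "1 - 3 * (q * (real n)\<^sup>2 / (2 * a\<^sup>2) + q\<^sup>2 * real n ^ 3 / a)
    \<le> measure_pmf.prob (random_graph n p) {E. hamiltonian n (H \<union> E)}"
    using p by (intro prob_hamiltonian_ge[OF H k k2 k11 q0 _ _ a0 a0 kk]) (auto simp: q_def)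
  have "q * (real n)\<^sup>2 / (2 * a\<^sup>2) \<le> 256 / \<epsilon>\<^sup>2 * inverse \<eta>"
  proof -
    have "q * (real n)\<^sup>2 / (2 * a\<^sup>2) = (1 + \<epsilon>) * (128 / \<epsilon>\<^sup>2 * inverse \<eta>)"
      using nz unfolding q_def a_def power2_eq_square by (simp add: divide_simps)
    also have "\<dots> \<le> 2 * (128 / \<epsilon>\<^sup>2 * inverse \<eta>)" using \<epsilon> \<eta> by (intro mult_right_mono) auto
    finally show ?thesis by simp
  qed
  moreover have "q\<^sup>2 * real n ^ 3 / a \<le> 4096 / \<epsilon> * (\<eta> / real n)"
  proof -
    have "q\<^sup>2 * real n ^ 3 / a = (1 + \<epsilon>)\<^sup>2 * (1024 / \<epsilon> * (\<eta> / real n))"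
      using nz unfolding q_def a_def power2_eq_square power3_eq_cube by (simp add: divide_simps)
    also have "\<dots> \<le> 2\<^sup>2 * (1024 / \<epsilon> * (\<eta> / real n))"
      using \<epsilon> \<eta> by (intro mult_right_mono power_mono) auto
    finally show ?thesis by simp
  qed
  ultimately have "1 - 3 * (256 / \<epsilon>\<^sup>2 * inverse \<eta> + 4096 / \<epsilon> * (\<eta> / real n))
      \<le> 1 - 3 * (q * (real n)\<^sup>2 / (2 * a\<^sup>2) + q\<^sup>2 * real n ^ 3 / a)"
    by (intro diff_left_mono mult_left_mono add_mono) simp_all
  then show ?thesis using main by (rule order_trans)
qed

theorem theorem1p3:
  fixes d :: "nat \<Rightarrow> int" and \<eta> :: "nat \<Rightarrow> real" and \<epsilon> :: real
  assumes "\<And>n. real_of_int (d n) = real n / 2 - \<eta> n"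
    and "filterlim \<eta> at_top sequentially"
    and "\<eta> \<in> o(\<lambda>n. real n)"
    and "\<epsilon> > 0"
  shows "(\<exists>H :: nat \<Rightarrow> nat set set.
            (\<forall>n. simple_graph n (H n)) \<and>
            (\<forall>n>0. d n < int n \<longrightarrow> int (min_degree n (H n)) \<ge> d n) \<and>
            (\<forall>p :: nat \<Rightarrow> real.
               (\<forall>n. 0 \<le> p n \<and> p n \<le> 1) \<and>
               (\<forall>\<^sub>F n in sequentially. p n \<le> (1 - \<epsilon>) * (16 * \<eta> n / (real n)\<^sup>2)) \<longrightarrow>
               (\<lambda>n. measure_pmf.prob (random_graph n (p n)) {E. hamiltonian n (H n \<union> E)})
                 \<longlonglongrightarrow> 0)) \<and>
         (\<forall>H :: nat \<Rightarrow> nat set set.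
            (\<forall>n. simple_graph n (H n)) \<and>
            (\<forall>\<^sub>F n in sequentially. int (min_degree n (H n)) \<ge> d n) \<longrightarrow>
            (\<forall>p :: nat \<Rightarrow> real.
               (\<forall>n. 0 \<le> p n \<and> p n \<le> 1) \<and>
               (\<forall>\<^sub>F n in sequentially. p n \<ge> (1 + \<epsilon>) * (16 * \<eta> n / (real n)\<^sup>2)) \<longrightarrow>
               (\<lambda>n. measure_pmf.prob (random_graph n (p n)) {E. hamiltonian n (H n \<union> E)})
                 \<longlonglongrightarrow> 1))"
proof -
  have ev_n: "\<forall>\<^sub>F n in sequentially. 0 < n" by (rule eventually_gt_at_top)
  have ev_\<eta>: "\<forall>\<^sub>F n in sequentially. 1 \<le> \<eta> n"
    using assms(2) by (simp add: filterlim_at_top)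
  have ev_o: "\<forall>\<^sub>F n in sequentially. \<eta> n \<le> c * real n" if "0 < c" for c
    using landau_o.smallD[OF assms(3) that] by eventually_elim auto
  have inv: "(\<lambda>n. inverse (\<eta> n)) \<longlonglongrightarrow> 0"
    by (rule tendsto_inverse_0_at_top[OF assms(2)])
  have quot: "(\<lambda>n. \<eta> n / real n) \<longlonglongrightarrow> 0"
    by (rule smalloD_tendsto[OF assms(3)])
  \<comment> \<open>Once \<open>\<eta> n\<close> is small against \<open>n\<close>,
    \<open>d n\<close> is nonnegative and \<open>nat\<close> preserves its value.\<close>
  have D: "real (nat (d n)) = real n / 2 - \<eta> n" if "\<eta> n \<le> 1 / 50 * real n" for n
  proof -
    have "0 \<le> real_of_int (d n)" using that assms(1)[of n] by simp
    then show ?thesis using assms(1)[of n] by simp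
  qed
  show ?thesis
  proof (intro conjI exI[of _ "\<lambda>n. extremal_graph n (d n)"] allI impI)
    fix p :: "nat \<Rightarrow> real"
    assume p: "(\<forall>n. 0 \<le> p n \<and> p n \<le> 1) \<and>
      (\<forall>\<^sub>F n in sequentially. p n \<le> (1 - \<epsilon>) * (16 * \<eta> n / (real n)\<^sup>2))"
    \<comment> \<open>Passing to \<open>\<delta>\<close> relaxes the upper bound on \<open>p\<close>
      and meets the restriction to at most \<open>1 / 2\<close> in the estimate.\<close>
    define \<delta> where "\<delta> = min \<epsilon> (1 / 2)"
    have \<delta>: "0 < \<delta>" "\<delta> \<le> 1 / 2" "\<delta> \<le> \<epsilon>" using assms(4) by (auto simp: \<delta>_def)
    from p have "\<forall>\<^sub>F n in sequentially. p n \<le> (1 - \<epsilon>) * (16 * \<eta> n / (real n)\<^sup>2)" by blast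
    moreover have "\<forall>\<^sub>F n in sequentially. \<eta> n \<le> \<delta> / 16 * real n" using \<delta> by (intro ev_o) simp
    moreover have "\<forall>\<^sub>F n in sequentially. \<eta> n \<le> 1 / 50 * real n" by (intro ev_o) simp
    ultimately have "\<forall>\<^sub>F n in sequentially.
      measure_pmf.prob (random_graph n (p n)) {E. hamiltonian n (extremal_graph n (d n) \<union> E)}
        \<le> 2 / \<delta>\<^sup>2 * inverse (\<eta> n)"
      using ev_n ev_\<eta>
    proof eventually_elim
      case (elim n)
      have "(1 - \<epsilon>) * (16 * \<eta> n / (real n)\<^sup>2) \<le> (1 - \<delta>) * (16 * \<eta> n / (real n)\<^sup>2)"
        using \<delta> elim by (intro mult_right_mono) auto
      then have "p n \<le> (1 - \<delta>) * (16 * \<eta> n / (real n)\<^sup>2)" using elim by linarith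
      \<comment> \<open>Eventually \<open>\<eta> n\<close> is positive, which selects the bipartite
        branch of \<open>extremal_graph\<close>.\<close>
      moreover have "2 * d n \<le> int n"
      proof -
        have "real_of_int (2 * d n) \<le> real_of_int (int n)" using assms(1)[of n] elim by simp
        then show ?thesis by (simp only: of_int_le_iff)
      qed
      ultimately show ?case
        unfolding extremal_graph_def using prob_extremal_hamiltonian_le[OF D, of n \<delta> "p n"] elim \<delta> p by simp
    qed
    moreover have "(\<lambda>n. 2 / \<delta>\<^sup>2 * inverse (\<eta> n)) \<longlonglongrightarrow> 0"
      using tendsto_mult_left[OF inv, of "2 / \<delta>\<^sup>2"] by simp
    ultimately show "(\<lambda>n. measure_pmf.prob (random_graph n (p n)) {E. hamiltonian n (extremal_graph n (d n) \<union> E)})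
        \<longlonglongrightarrow> 0"
      by (rule tendsto_sandwich[OF always_eventually _ tendsto_const[of 0], rotated]) simp
  next
    fix H :: "nat \<Rightarrow> nat set set" and p :: "nat \<Rightarrow> real"
    assume H: "(\<forall>n. simple_graph n (H n)) \<and> (\<forall>\<^sub>F n in sequentially. int (min_degree n (H n)) \<ge> d n)"
      and p: "(\<forall>n. 0 \<le> p n \<and> p n \<le> 1) \<and>
        (\<forall>\<^sub>F n in sequentially. p n \<ge> (1 + \<epsilon>) * (16 * \<eta> n / (real n)\<^sup>2))"
    define \<delta> where "\<delta> = min \<epsilon> 1"
    have \<delta>: "0 < \<delta>" "\<delta> \<le> 1" "\<delta> \<le> \<epsilon>" using assms(4) by (auto simp: \<delta>_def)
    let ?b = "\<lambda>n. 1 - 3 * (256 / \<delta>\<^sup>2 * inverse (\<eta> n) + 4096 / \<delta> * (\<eta> n / real n))"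
    from p have "\<forall>\<^sub>F n in sequentially. p n \<ge> (1 + \<epsilon>) * (16 * \<eta> n / (real n)\<^sup>2)" by blast
    moreover from H have "\<forall>\<^sub>F n in sequentially. int (min_degree n (H n)) \<ge> d n" by blast
    moreover have "\<forall>\<^sub>F n in sequentially. \<eta> n \<le> \<delta> / 50 * real n" using \<delta> by (intro ev_o) simp
    moreover have "\<forall>\<^sub>F n in sequentially. \<eta> n \<le> 1 / 50 * real n" by (intro ev_o) simp
    ultimately have "\<forall>\<^sub>F n in sequentially.
      ?b n \<le> measure_pmf.prob (random_graph n (p n)) {E. hamiltonian n (H n \<union> E)}"
      using ev_n ev_\<eta>
    proof eventually_elim
      case (elim n)
      have "(1 + \<delta>) * (16 * \<eta> n / (real n)\<^sup>2) \<le> (1 + \<epsilon>) * (16 * \<eta> n / (real n)\<^sup>2)"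
        using \<delta> elim by (intro mult_right_mono) auto
      then have pn: "(1 + \<delta>) * (16 * \<eta> n / (real n)\<^sup>2) \<le> p n" using elim by linarith
      have G: "simple_graph n (H n)" using H by blast
      have "nat (d n) \<le> card (nbrs (H n) v)" if "v < n" for v
        using elim by (intro card_nbrs_ge_min_degree[OF G that]) linarith
      then show ?case
        using G D[of n] elim \<delta> p pn by (intro prob_perturbed_hamiltonian_ge) auto
    qed
    moreover have "\<forall>n. measure_pmf.prob (random_graph n (p n)) {E. hamiltonian n (H n \<union> E)} \<le> 1" by simp
    moreover have "?b \<longlonglongrightarrow> 1"
      using tendsto_diff[OF tendsto_const[of 1] tendsto_mult_left[OF tendsto_add[OF
        tendsto_mult_left[OF inv, of "256 / \<delta>\<^sup>2"] tendsto_mult_left[OF quot, of "4096 / \<delta>"]], of 3]]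
      by simp
    ultimately show "(\<lambda>n. measure_pmf.prob (random_graph n (p n)) {E. hamiltonian n (H n \<union> E)}) \<longlonglongrightarrow> 1"
      by (rule tendsto_sandwich[OF _ always_eventually _ tendsto_const[of 1]])
  qed (simp_all add: simple_graph_extremal min_degree_extremal)
qed

end
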